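(* Let $p$ be a prime, $q=p^e$, and let $A=\mathbb{Z}_{n_1}\times\cdots\times\mathbb{Z}_{n_h}$ be an abelian group of exponent $N$ with $\gcd(N,q)=1$. Let $m=\mathrm{ord}_N(q)$ and for each $\ell\in[h]$ let $\gamma_\ell$ be a primitive $n_\ell$-th root of unity in $\mathbb{F}_{q^m}$. Let $(s_{i,1},\dots,s_{i,h})\in A$ for $1\le i\le k$, and let $C\subseteq\mathbb{F}_q[A]$ be the code \[C=\Big\{\Big(\mathrm{Tr}_{q^m/q}\Big(\sum_{i=1}^k\alpha_i\prod_{\ell=1}^h\gamma_\ell^{s_{i,\ell}j_\ell}\Big)\Big)_{(j_1,\dots,j_h)\in A}:(\alpha_1,\dots,\alpha_k)\in\mathbb{F}_{q^m}^k\Big\}.\] Then the $p$-adic valuation of $C$ equals the minimum of $\frac{1}{p-1}\sum_{i=1}^kS_p(r_i)-e$ over all $\boldsymbol{r}=(r_1,\dots,r_k)\in[0,q^m-1]^k$ such that $|\boldsymbol{r}|=\sum_ir_i>0$, $|\boldsymbol{r}|\equiv0\pmod{q-1}$, and $\sum_{i=1}^k r_is_{i,\ell}\equiv0\pmod{n_\ell}$ for all $1\le\ell\le h$.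
   Context: The $p$-adic valuation of a linear code over $\mathbb{F}_q$ is the greatest integer $t$ such that the Hamming weight of every codeword is divisible by $p^t$. $S_p(a)$ is the sum of the base-$p$ digits of $a$; $[a,b]=\{i\in\mathbb{Z}:a\le i\le b\}$, $[h]=[1,h]$. $\mathrm{Tr}_{q^m/q}$ is the trace from $\mathbb{F}_{q^m}$ to $\mathbb{F}_q$. *)

theory Defs
  imports "HOL-Number_Theory.Number_Theory"
begin

fun digit_sum :: "nat \<Rightarrow> nat \<Rightarrow> nat" where
  "digit_sum p a = (if p < 2 \<or> a = 0 then 0 else a mod p + digit_sum p (a div p))"

definition hamming_weight :: "'i set \<Rightarrow> ('i \<Rightarrow> 'a::zero) \<Rightarrow> nat" where
  "hamming_weight I c = card {j \<in> I. c j \<noteq> 0}"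

definition code_p_adic_valuation :: "nat \<Rightarrow> 'i set \<Rightarrow> ('i \<Rightarrow> 'a::zero) set \<Rightarrow> nat" where
  "code_p_adic_valuation p I C = (GREATEST t. \<forall>c\<in>C. p ^ t dvd hamming_weight I c)"

definition trace :: "nat \<Rightarrow> nat \<Rightarrow> 'a::field \<Rightarrow> 'a" where
  "trace q m x = (\<Sum>i<m. x ^ (q ^ i))"

definition primitive_root_of_unity :: "nat \<Rightarrow> 'a::field \<Rightarrow> bool" where
  "primitive_root_of_unity n x \<longleftrightarrow> 0 < n \<and> x ^ n = 1 \<and> (\<forall>d. 0 < d \<and> d < n \<longrightarrow> x ^ d \<noteq> 1)"

end

theory Submission
  imports Defs "HOL-Computational_Algebra.Computational_Algebra" "HOL-Library.Cardinality"
begin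

text \<open>
  Let \<open>Q = q ^ m\<close>. Fix a Teichmueller character \<open>T\<close> of the field with \<open>Q\<close> elements and a nontrivial
  additive character \<open>\<psi>\<close>, both with values in a local ring \<open>\<O>\<close> of complex numbers whose residue
  field contains that field, and let \<open>\<pi> = \<zeta> - 1\<close> for a primitive \<open>p\<close>-th root of unity \<open>\<zeta>\<close>.
  The coefficients of the expansion \<open>\<psi> x = (\<Sum>r<Q. c r * T x ^ r)\<close> are Gauss sums up to units, and
  by Stickelberger's theorem \<open>c r\<close> is associated to \<open>\<pi> ^ digit_sum p r\<close>. Counting the zeros of a
  codeword with \<open>\<psi>\<close> and expanding gives
  \<open>q * weight \<alpha> = - (q - 1) * |A| * (\<Sum>r. (\<Prod>i. c (r i)) * (\<Prod>i. T (\<alpha> i) ^ r i))\<close>, where \<open>r\<close> runs over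
  the exponent vectors of the theorem. The monomials in \<open>T (\<alpha> i)\<close> are linearly independent even modulo
  the maximal ideal, so the least valuation of \<open>q * weight \<alpha>\<close> over all \<open>\<alpha>\<close> is the least valuation of
  a coefficient.

  Stickelberger's theorem needs only divisibility in \<open>\<O>\<close>: Jacobi sums give
  \<open>gauss r\<close> divides \<open>\<pi> ^ digit_sum p r\<close>, and since \<open>gauss r * gauss (Q - 1 - r)\<close> is \<open>Q\<close> up to a
  root of unity while the digit sums of \<open>r\<close> and \<open>Q - 1 - r\<close> are complementary, equality holds.
\<close>

section \<open>Reduction of roots of unity to a finite field\<close>

abbreviation int_poly_eval :: "int poly \<Rightarrow> 'b::comm_ring_1 \<Rightarrow> 'b" where
  "int_poly_eval f x \<equiv> poly (map_poly of_int f) x"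

lemma map_poly_of_int_mult:
  "map_poly of_int (f * g) = (map_poly of_int f * map_poly of_int g :: 'b::comm_ring_1 poly)"
  by (rule poly_eqI) (simp add: coeff_map_poly coeff_mult)

lemma map_poly_of_int_add:
  "map_poly of_int (f + g) = (map_poly of_int f + map_poly of_int g :: 'b::comm_ring_1 poly)"
  by (rule poly_eqI) (simp add: coeff_map_poly)

lemma map_poly_of_int_diff:
  "map_poly of_int (f - g) = (map_poly of_int f - map_poly of_int g :: 'b::comm_ring_1 poly)"
  by (rule poly_eqI) (simp add: coeff_map_poly)

lemma map_poly_of_int_uminus:
  "map_poly of_int (- f) = (- map_poly of_int f :: 'b::comm_ring_1 poly)"
  by (rule poly_eqI) (simp add: coeff_map_poly)

lemma map_poly_of_int_smult:
  "map_poly of_int (smult c f) = (smult (of_int c) (map_poly of_int f) :: 'b::comm_ring_1 poly)"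
  by (rule poly_eqI) (simp add: coeff_map_poly)

lemma map_poly_of_int_monom:
  "map_poly of_int (monom c n) = (monom (of_int c) n :: 'b::comm_ring_1 poly)"
  by (rule poly_eqI) (simp add: coeff_map_poly)

lemma map_poly_of_int_1: "map_poly of_int (1 :: int poly) = (1 :: 'b::comm_ring_1 poly)"
  by (rule poly_eqI) (simp add: coeff_map_poly)

lemmas map_poly_of_int_simps = map_poly_of_int_mult map_poly_of_int_add map_poly_of_int_diff
  map_poly_of_int_uminus map_poly_of_int_smult map_poly_of_int_monom map_poly_of_int_1

text \<open>By Gauss's lemma contents multiply, so the cofactor of \<open>g\<close> carries the
  whole content of \<open>smult c f\<close>; in particular \<open>c\<close> can be divided out of
  it.\<close>

lemma primitive_dvd_smultD:
  fixes f g :: "int poly"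
  assumes "content g = 1" "c \<noteq> 0" "g dvd smult c f"
  shows "g dvd f"
proof -
  from assms(3) obtain h where h: "smult c f = g * h" by (elim dvdE)
  have "content (smult c f) = content g * content h" by (simp only: h content_mult)
  hence "content h = content (smult c f)" using assms(1) by simp
  hence "c dvd content h" by simp
  hence "[:c:] dvd h" by (simp add: const_poly_dvd_iff_dvd_content)
  then obtain h' where "h = smult c h'" by (auto elim!: dvdE)
  with h have "smult c f = smult c (g * h')" by simp
  hence "[:c:] * f = [:c:] * (g * h')" by simp
  hence "f = g * h'" using assms(2) by (subst (asm) mult_cancel_left) simp
  thus ?thesis by simp
qed

lemma degree_monom_minus_1:
  "0 < n \<Longrightarrow> degree (monom 1 n - 1 :: 'b::comm_ring_1 poly) = n"
  unfolding diff_conv_add_uminus by (subst degree_add_eq_left) (auto simp: degree_monom_eq)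

text \<open>A nonzero integer polynomial of least degree with root \<open>x\<close> is made
  primitive; pseudo-division and \<open>primitive_dvd_smultD\<close> show that it divides all
  others. As a factor of the monic \<open>monom 1 n - 1\<close> it has leading coefficient 1 or
  -1.\<close>

lemma root_of_unity_minimal_poly:
  fixes x :: complex
  assumes "0 < n" "x ^ n = 1"
  obtains \<Psi> :: "int poly" where "lead_coeff \<Psi> = 1"
    and "\<And>f. int_poly_eval f x = 0 \<longleftrightarrow> \<Psi> dvd f"
proof -
  define P where "P f \<longleftrightarrow> f \<noteq> 0 \<and> int_poly_eval f x = 0" for f :: "int poly"
  define X :: "int poly" where "X = monom 1 n - 1"
  have X0: "X \<noteq> 0"
  proof
    assume "X = 0"
    hence "coeff X n = 0" by simp
    thus False using assms(1) by (simp add: X_def)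
  qed
  have Xx: "int_poly_eval X x = 0"
    using assms(2) by (simp add: X_def map_poly_of_int_simps poly_monom)
  have "P X" using X0 Xx by (simp add: P_def)
  then obtain \<Psi>0 where \<Psi>0: "P \<Psi>0" "\<And>f. P f \<Longrightarrow> degree \<Psi>0 \<le> degree f"
    using ex_has_least_nat[of P X degree] by blast
  define \<Psi>1 where "\<Psi>1 = primitive_part \<Psi>0"
  have n0: "\<Psi>0 \<noteq> 0" using \<Psi>0(1) by (simp add: P_def)
  have n1: "\<Psi>1 \<noteq> 0" using n0 by (simp add: \<Psi>1_def)
  have deg1: "degree \<Psi>1 = degree \<Psi>0" by (simp add: \<Psi>1_def)
  have "\<Psi>0 = smult (content \<Psi>0) \<Psi>1" by (simp add: \<Psi>1_def)
  hence "int_poly_eval \<Psi>0 x = of_int (content \<Psi>0) * int_poly_eval \<Psi>1 x"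
    by (metis map_poly_of_int_smult poly_smult)
  hence root1: "int_poly_eval \<Psi>1 x = 0"
    using \<Psi>0(1) n0 by (auto simp: P_def)
  have c1: "content \<Psi>1 = 1" using n0 by (simp add: \<Psi>1_def)
  have dvd1: "\<Psi>1 dvd f" if f: "int_poly_eval f x = 0" for f
  proof -
    obtain a q where aq: "a \<noteq> 0" "smult a f = \<Psi>1 * q + pseudo_mod f \<Psi>1"
      using pseudo_mod(1)[OF n1] by blast
    have "pseudo_mod f \<Psi>1 = smult a f - \<Psi>1 * q" using aq by simp
    hence "int_poly_eval (pseudo_mod f \<Psi>1) x = 0"
      using f root1 by (simp add: map_poly_of_int_simps)
    moreover have "\<not> P (pseudo_mod f \<Psi>1)" if "pseudo_mod f \<Psi>1 \<noteq> 0"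
      using \<Psi>0(2)[of "pseudo_mod f \<Psi>1"] pseudo_mod(2)[OF n1, of f] deg1 that by linarith
    ultimately have "pseudo_mod f \<Psi>1 = 0" unfolding P_def by blast
    hence "\<Psi>1 dvd smult a f" using aq by simp
    thus ?thesis using primitive_dvd_smultD[OF c1 aq(1)] by blast
  qed
  obtain Y where Y: "X = \<Psi>1 * Y" using dvd1[OF Xx] by (elim dvdE)
  have "degree X = n"
    unfolding X_def using assms(1) by (rule degree_monom_minus_1)
  hence "lead_coeff X = 1" using assms(1) by (simp add: X_def)
  hence "lead_coeff \<Psi>1 * lead_coeff Y = 1" using Y by (simp add: lead_coeff_mult)
  hence l: "lead_coeff \<Psi>1 * lead_coeff \<Psi>1 = 1"
    using zmult_eq_1_iff by auto
  \<comment> \<open>The leading coefficient squares to 1, so multiplying by it normalises either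
    sign.\<close>
  define \<Psi> where "\<Psi> = smult (lead_coeff \<Psi>1) \<Psi>1"
  have "lead_coeff \<Psi> = 1" using l n1 by (simp add: \<Psi>_def)
  moreover have "int_poly_eval f x = 0 \<longleftrightarrow> \<Psi> dvd f" for f
  proof
    assume "int_poly_eval f x = 0"
    then obtain h where "f = \<Psi>1 * h" using dvd1 by (blast elim: dvdE)
    hence "f = \<Psi> * smult (lead_coeff \<Psi>1) h" using l by (simp add: \<Psi>_def)
    thus "\<Psi> dvd f" by (rule dvdI)
  next
    assume "\<Psi> dvd f"
    then obtain h where "f = \<Psi> * h" by (elim dvdE)
    thus "int_poly_eval f x = 0" using root1 by (simp add: \<Psi>_def map_poly_of_int_simps)
  qed
  ultimately show thesis using that by blast
qed

lemma finite_field_pow_card_minus_1: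
  fixes x :: "'a::{field,finite}"
  assumes "x \<noteq> 0"
  shows "x ^ (CARD('a) - 1) = 1"
proof -
  have "(\<Prod>y\<in>UNIV-{0}. x * y) = (\<Prod>y\<in>UNIV-{0}. y)"
    by (rule prod.reindex_bij_witness[of _ "\<lambda>y. y / x" "\<lambda>y. x * y"]) (use assms in auto)
  moreover have "(\<Prod>y\<in>UNIV-{0}. x * y) = x ^ (CARD('a) - 1) * (\<Prod>y\<in>UNIV-{0}. y)"
    by (simp add: prod.distrib)
  moreover have "(\<Prod>y\<in>UNIV-{0::'a}. y) \<noteq> 0" by simp
  ultimately show ?thesis by simp
qed

lemma prod_linear_factors_dvd:
  fixes P :: "'a::field poly"
  assumes "finite S" "\<And>x. x \<in> S \<Longrightarrow> poly P x = 0"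
  shows "(\<Prod>x\<in>S. [:-x, 1:]) dvd P"
  using assms
proof (induction S arbitrary: P rule: finite_induct)
  case (insert a S)
  have "[:-a, 1:] dvd P" using insert.prems by (simp add: poly_eq_0_iff_dvd)
  then obtain P' where P': "P = [:-a, 1:] * P'" by (elim dvdE)
  have "poly P' x = 0" if "x \<in> S" for x
    using insert.prems[of x] insert.hyps that by (auto simp: P')
  hence "(\<Prod>x\<in>S. [:-x, 1:]) dvd P'" by (rule insert.IH)
  thus ?case using insert.hyps P' by (simp del: mult_pCons_left mult_pCons_right add: mult_dvd_mono)
qed auto

text \<open>The product of linear factors divides the left side; equal degrees and leading
  coefficients make the quotient 1.\<close>

lemma monom_minus_1_finite_field:
  "monom 1 (CARD('a) - 1) - 1 = (\<Prod>x\<in>UNIV-{0}. [:-x, 1 :: 'a::{field,finite}:])"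
proof -
  let ?n = "CARD('a) - 1" and ?P = "\<Prod>x\<in>UNIV-{0}. [:-x, 1 :: 'a:]"
  have n: "?n > 0" using finite_UNIV_card_ge_0[where 'a='a] card_mono[of UNIV "{0,1::'a}"] by simp
  have d: "degree (monom 1 ?n - 1 :: 'a poly) = ?n"
    using n by (rule degree_monom_minus_1)
  have "?P dvd monom 1 ?n - 1"
    using finite_field_pow_card_minus_1[where 'a='a]
    by (intro prod_linear_factors_dvd) (auto simp: poly_monom)
  then obtain R where R: "monom 1 ?n - 1 = ?P * R" by (elim dvdE)
  have dP: "degree ?P = ?n" by (subst degree_prod_eq_sum_degree) (auto)
  have lP: "lead_coeff ?P = 1" by (simp add: lead_coeff_prod)
  have ne: "monom 1 ?n - 1 \<noteq> (0 :: 'a poly)" using d n by auto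
  have "R \<noteq> 0" "?P \<noteq> 0" using ne R by auto
  hence "degree R = 0" using d R dP n by (simp add: degree_mult_eq)
  moreover have "lead_coeff R = 1"
    using arg_cong[OF R, of lead_coeff] lP d n by (simp add: lead_coeff_mult)
  ultimately have "R = 1" by (elim degree_eq_zeroE) simp
  thus ?thesis using R by simp
qed

lemma rootless_dvd_linear_multD:
  fixes F :: "'a::field poly"
  assumes "F dvd [:-a, 1:] * G" "poly F a \<noteq> 0"
  shows "F dvd G"
proof -
  from assms(1) obtain H where H: "[:-a, 1:] * G = F * H" by (elim dvdE)
  have "poly ([:-a, 1:] * G) a = 0" by simp
  hence "poly F a * poly H a = 0" by (simp only: H poly_mult)
  hence "poly H a = 0" using assms(2) by simp
  then obtain H' where "H = [:-a, 1:] * H'" unfolding poly_eq_0_iff_dvd by (rule dvdE)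
  hence "[:-a, 1:] * G = [:-a, 1:] * (F * H')" using H by (simp only: mult.left_commute)
  hence "G = F * H'" by (subst (asm) mult_cancel_left) simp
  thus ?thesis by simp
qed

text \<open>If \<open>F\<close> had no root in \<open>S\<close>, the linear factors could be
  cancelled one after another, and \<open>F\<close> would divide 1.\<close>

lemma dvd_prod_linear_factors_imp_root:
  fixes F :: "'a::field poly"
  assumes "F dvd (\<Prod>x\<in>S. [:-x, 1:]) ^ k" "degree F > 0"
  shows "\<exists>x\<in>S. poly F x = 0"
proof (rule ccontr)
  assume "\<not> ?thesis"
  hence nr: "\<And>x. x \<in> S \<Longrightarrow> poly F x \<noteq> 0" by blast
  have 1: "F dvd G" if "finite S'" "S' \<subseteq> S" "F dvd (\<Prod>x\<in>S'. [:-x, 1:]) * G" for S' G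
    using that
  proof (induction S' rule: finite_induct)
    case (insert a S')
    hence "F dvd [:-a, 1:] * ((\<Prod>x\<in>S'. [:-x, 1:]) * G)"
      by (simp del: mult_pCons_left mult_pCons_right add: mult.assoc)
    hence "F dvd (\<Prod>x\<in>S'. [:-x, 1:]) * G"
      by (rule rootless_dvd_linear_multD) (use nr insert.prems in auto)
    thus ?case using insert by simp
  qed simp
  have "F dvd 1"
  proof (cases "finite S")
    case True
    have "F dvd (\<Prod>x\<in>S. [:-x, 1:]) ^ j \<Longrightarrow> F dvd 1" for j
    proof (induction j)
      case (Suc j)
      from Suc.prems have "F dvd (\<Prod>x\<in>S. [:-x, 1:]) ^ j"
        unfolding power_Suc by (rule 1[OF True order.refl])
      thus ?case by (rule Suc.IH)
    qed simp
    thus ?thesis using assms(1) by blast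
  qed (use assms(1) in simp)
  thus False using assms(2) is_unit_iff_degree[of F] by (cases "F = 0") auto
qed

lemma finite_field_CHAR:
  assumes "prime p" "CARD('a::{field,finite}) = p ^ n"
  shows "CHAR('a) = p"
proof -
  have "CHAR('a) dvd p ^ n" using CHAR_dvd_CARD[where 'a='a] assms(2) by simp
  moreover have "prime CHAR('a)"
    by (rule prime_CHAR_semidom) (simp add: finite_imp_CHAR_pos)
  ultimately show ?thesis using assms(1) prime_dvd_power primes_dvd_imp_eq by blast
qed

text \<open>Reduction modulo a prime above \<^term>\<open>p\<close> of the cyclotomic ring generated by \<^term>\<open>\<eta>\<close>, as
  the evaluation of integer polynomials at a root of the reduced minimal polynomial.\<close>

lemma cyclotomic_reduction_exists:
  fixes \<eta> :: complex
  assumes "prime p" "CARD('a::{field,finite}) = p ^ f"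
    and "\<eta> ^ ((CARD('a) - 1) * p) = 1"
  obtains g :: "'a::{field,finite}" where "\<And>F. int_poly_eval F \<eta> = 0 \<Longrightarrow> int_poly_eval F g = 0"
proof -
  let ?n = "CARD('a) - 1"
  have n: "?n > 0" using card_mono[of UNIV "{0,1::'a}"] by simp
  have p: "p > 0" using assms(1) prime_gt_0_nat by blast
  have char: "CHAR('a) = p" by (rule finite_field_CHAR[OF assms(1,2)])
  have "?n * p > 0" using n p by simp
  then obtain \<Psi> where \<Psi>: "lead_coeff \<Psi> = 1"
    "\<And>F. int_poly_eval F \<eta> = 0 \<longleftrightarrow> \<Psi> dvd F"
    using root_of_unity_minimal_poly[OF _ assms(3)] by blast
  have "int_poly_eval (monom 1 (?n * p) - 1) \<eta> = 0"
    using assms(3) by (simp add: map_poly_of_int_simps poly_monom)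
  hence "\<Psi> dvd monom 1 (?n * p) - 1" by (simp only: \<Psi>(2))
  then obtain H where H: "monom 1 (?n * p) - 1 = \<Psi> * H" by (rule dvdE)
  let ?R = "map_poly of_int :: int poly \<Rightarrow> 'a poly"
  have charP: "CHAR('a poly) = p" using char by simp
  \<comment> \<open>In characteristic \<open>p\<close> the reduced polynomial is a
    \<open>p\<close>-th power of one that splits into distinct linear factors over the
    field.\<close>
  have "?R (monom 1 (?n * p) - 1) = monom 1 ?n ^ p - 1"
    by (simp add: map_poly_of_int_simps monom_power)
  also have "\<dots> = (monom 1 ?n - 1) ^ p"
  proof -
    have "(monom 1 ?n - 1 + 1 :: 'a poly) ^ p = (monom 1 ?n - 1) ^ p + 1 ^ p"
      by (rule freshmans_dream) (use charP assms(1) in auto)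
    thus ?thesis by simp
  qed
  finally have "?R \<Psi> * ?R H = (\<Prod>x\<in>UNIV-{0}. [:-x, 1:]) ^ p"
    by (simp only: H map_poly_of_int_mult monom_minus_1_finite_field)
  hence dvd: "?R \<Psi> dvd (\<Prod>x\<in>UNIV-{0}. [:-x, 1:]) ^ p" by (metis dvd_triv_left)
  have "degree \<Psi> > 0"
  proof (rule ccontr)
    assume "\<not> degree \<Psi> > 0"
    hence "degree \<Psi> = 0" by simp
    hence "\<Psi> = 1" using \<Psi>(1) by (elim degree_eq_zeroE) simp
    hence "int_poly_eval 1 \<eta> = 0" by (simp only: \<Psi>(2)) simp
    thus False by (simp add: map_poly_of_int_simps)
  qed
  \<comment> \<open>A monic polynomial keeps its degree under reduction, so the reduced one is
    nonconstant and has a root in the field.\<close>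
  moreover have "degree (?R \<Psi>) = degree \<Psi>"
    using \<Psi>(1) by (intro antisym degree_le le_degree) (auto simp: coeff_map_poly coeff_eq_0)
  ultimately obtain g where g: "poly (?R \<Psi>) g = 0"
    using dvd_prod_linear_factors_imp_root[OF dvd] by auto
  show thesis
  proof (rule that[of g])
    fix F assume "int_poly_eval F \<eta> = 0"
    hence "\<Psi> dvd F" by (simp only: \<Psi>(2))
    then obtain G where "F = \<Psi> * G" by (rule dvdE)
    thus "int_poly_eval F g = 0" using g by (simp add: map_poly_of_int_mult)
  qed
qed

section \<open>The Teichmueller character\<close>

text \<open>\<open>\<O>\<close> is the local ring and \<open>\<rho>\<close> its reduction map,
  constrained on \<open>\<O>\<close> only. Locality is expressed by \<open>inverse_mem\<close>:
  whatever does not reduce to 0 is invertible in \<open>\<O>\<close>. \<open>T\<close> is a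
  multiplicative section of \<open>\<rho>\<close>.\<close>

locale teichmueller =
  fixes p f Q :: nat and \<O> :: "complex set" and \<rho> :: "complex \<Rightarrow> 'a::{field,finite}"
    and T :: "'a \<Rightarrow> complex" and \<zeta> :: complex
  assumes prime_p: "prime p" and Q_eq: "Q = p ^ f" and card_UNIV: "CARD('a) = Q"
    and one_mem [simp]: "1 \<in> \<O>"
    and add_mem [simp]: "\<And>a b. a \<in> \<O> \<Longrightarrow> b \<in> \<O> \<Longrightarrow> a + b \<in> \<O>"
    and mult_mem [simp]: "\<And>a b. a \<in> \<O> \<Longrightarrow> b \<in> \<O> \<Longrightarrow> a * b \<in> \<O>"
    and uminus_mem [simp]: "\<And>a. a \<in> \<O> \<Longrightarrow> - a \<in> \<O>"
    and \<rho>_1 [simp]: "\<rho> 1 = 1"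
    and \<rho>_add [simp]: "\<And>a b. a \<in> \<O> \<Longrightarrow> b \<in> \<O> \<Longrightarrow> \<rho> (a + b) = \<rho> a + \<rho> b"
    and \<rho>_mult [simp]: "\<And>a b. a \<in> \<O> \<Longrightarrow> b \<in> \<O> \<Longrightarrow> \<rho> (a * b) = \<rho> a * \<rho> b"
    and inverse_mem: "\<And>a. a \<in> \<O> \<Longrightarrow> \<rho> a \<noteq> 0 \<Longrightarrow> inverse a \<in> \<O>"
    and T_mem [simp]: "\<And>x. T x \<in> \<O>" and \<rho>_T [simp]: "\<And>x. \<rho> (T x) = x"
    and T_0 [simp]: "T 0 = 0" and T_mult: "\<And>x y. T (x * y) = T x * T y"
    and \<zeta>_mem [simp]: "\<zeta> \<in> \<O>" and \<zeta>_pow_p: "\<zeta> ^ p = 1" and \<zeta>_neq_1: "\<zeta> \<noteq> 1"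

text \<open>\<open>\<O>\<close> is the ring of integer polynomials in a root of unity
  \<open>\<eta>\<close>, localised at the kernel of the reduction sending \<open>\<eta>\<close> to
  \<open>g\<close>. \<open>T\<close> inverts this reduction on the roots of unity of order dividing
  \<open>CARD('a) - 1\<close>.\<close>

lemma teichmueller_exists:
  assumes "prime p" "CARD('a::{field,finite}) = p ^ f"
  obtains \<O> \<rho> and T :: "'a::{field,finite} \<Rightarrow> complex" and \<zeta> where "teichmueller p f (p ^ f) \<O> \<rho> T \<zeta>"
proof -
  define n where "n = CARD('a) - 1"
  have n: "n > 0" using card_mono[of UNIV "{0,1::'a}"] by (simp add: n_def)
  have card_eq: "CARD('a) = n + 1" using n by (simp add: n_def)
  have p: "p > 1" using assms(1) prime_gt_1_nat by blast
  \<comment> \<open>The order \<open>n * p\<close> provides both the \<open>n\<close>-th roots of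
    unity for \<open>T\<close> and a \<open>p\<close>-th root of unity for
    \<open>\<zeta>\<close>.\<close>
  define \<eta> where "\<eta> = cis (2 * pi / real (n * p))"
  have \<eta>_pow: "\<eta> ^ k = cis (2 * pi * real k / real (n * p))" for k
    by (simp add: \<eta>_def DeMoivre mult_ac)
  have "\<eta> ^ (n * p) = cis (2 * pi)" using n p by (subst \<eta>_pow) simp
  hence \<eta>1: "\<eta> ^ (n * p) = 1" by simp
  obtain g :: 'a where g: "\<And>F. int_poly_eval F \<eta> = 0 \<Longrightarrow> int_poly_eval F g = 0"
    using cyclotomic_reduction_exists[OF assms, of \<eta>] \<eta>1 by (auto simp: n_def)
  \<comment> \<open>The graph of the reduction: \<open>z\<close> is a fraction of polynomials in
    \<open>\<eta>\<close> whose denominator does not vanish at \<open>g\<close>, and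
    \<open>v\<close> is the same fraction at \<open>g\<close>.\<close>
  define rel where "rel z v \<longleftrightarrow> (\<exists>F H. int_poly_eval H g \<noteq> 0 \<and>
      z * int_poly_eval H \<eta> = int_poly_eval F \<eta> \<and> v * int_poly_eval H g = int_poly_eval F g)"
    for z and v :: 'a
  define \<O> where "\<O> = {z. \<exists>v. rel z v}"
  define \<rho> where "\<rho> z = (SOME v. rel z v)" for z
  have rel_unique: "v = w" if "rel z v" "rel z w" for z v w
  proof -
    from that obtain F H F' H' where *: "int_poly_eval H g \<noteq> 0" "int_poly_eval H' g \<noteq> 0"
      "z * int_poly_eval H \<eta> = int_poly_eval F \<eta>" "z * int_poly_eval H' \<eta> = int_poly_eval F' \<eta>"
      "v * int_poly_eval H g = int_poly_eval F g" "w * int_poly_eval H' g = int_poly_eval F' g"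
      unfolding rel_def by blast
    \<comment> \<open>Two fractions for the same \<open>z\<close> have a cross difference vanishing
      at \<open>\<eta>\<close>, hence at \<open>g\<close>, so the value at \<open>g\<close> is well
      defined.\<close>
    have "int_poly_eval (F * H' - F' * H) \<eta> = 0"
      by (simp add: map_poly_of_int_simps flip: *(3,4))
    hence "int_poly_eval (F * H' - F' * H) g = 0" by (rule g)
    hence "(v - w) * (int_poly_eval H g * int_poly_eval H' g) = 0"
      by (simp add: map_poly_of_int_simps algebra_simps flip: *(5,6))
    thus ?thesis using *(1,2) by simp
  qed
  have relI: "z \<in> \<O> \<and> \<rho> z = v" if "rel z v" for z v
    using that rel_unique unfolding \<O>_def \<rho>_def by (blast intro: someI)
  have relD: "rel z (\<rho> z)" if "z \<in> \<O>" for z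
    using that unfolding \<O>_def \<rho>_def by (blast intro: someI)
  have rel_poly: "rel (int_poly_eval F \<eta>) (int_poly_eval F g)" for F
    unfolding rel_def by (intro exI[of _ F] exI[of _ 1]) (simp add: map_poly_of_int_simps)
  have rel1: "rel 1 1" using rel_poly[of 1] by (simp add: map_poly_of_int_simps)
  have rel_add: "rel (z + z') (v + v')" and rel_mult: "rel (z * z') (v * v')"
    if "rel z v" "rel z' v'" for z z' v v'
  proof -
    from that obtain F H F' H' where *: "int_poly_eval H g \<noteq> 0" "int_poly_eval H' g \<noteq> 0"
      "z * int_poly_eval H \<eta> = int_poly_eval F \<eta>" "z' * int_poly_eval H' \<eta> = int_poly_eval F' \<eta>"
      "v * int_poly_eval H g = int_poly_eval F g" "v' * int_poly_eval H' g = int_poly_eval F' g"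
      unfolding rel_def by blast
    show "rel (z + z') (v + v')"
      unfolding rel_def using *(1,2)
      by (intro exI[of _ "F * H' + F' * H"] exI[of _ "H * H'"])
        (simp add: map_poly_of_int_simps algebra_simps flip: *(3-6))
    show "rel (z * z') (v * v')"
      unfolding rel_def using *(1,2)
      by (intro exI[of _ "F * F'"] exI[of _ "H * H'"])
        (simp add: map_poly_of_int_simps algebra_simps flip: *(3-6))
  qed
  have rel_uminus: "rel (- z) (- v)" if "rel z v" for z v
    using rel_mult[OF rel_poly[of "-1"] that] by (simp add: map_poly_of_int_simps)
  have rel_inverse: "rel (inverse z) (inverse v)" if "rel z v" "v \<noteq> 0" for z v
  proof -
    from that obtain F H where *: "int_poly_eval H g \<noteq> 0"
      "z * int_poly_eval H \<eta> = int_poly_eval F \<eta>" "v * int_poly_eval H g = int_poly_eval F g"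
      unfolding rel_def by blast
    have Fg: "int_poly_eval F g \<noteq> 0" using * that by auto
    hence "int_poly_eval F \<eta> \<noteq> 0" using g by blast
    hence "z \<noteq> 0" using *(2) by auto
    show ?thesis unfolding rel_def using Fg \<open>z \<noteq> 0\<close> that(2)
      by (intro exI[of _ H] exI[of _ F]) (simp flip: *(2,3))
  qed
  have rel_\<eta>: "rel (\<eta> ^ k) (g ^ k)" for k
    using rel_poly[of "monom 1 k"] by (simp add: map_poly_of_int_simps poly_monom)

  define U where "U = {z :: complex. z ^ n = 1}"
  have cardU: "card U = n" using n by (simp add: U_def card_roots_unity_eq)
  have U_mem: "z \<in> \<O>" if "z \<in> U" for z
  proof -
    from that obtain k where "z = cis (2 * pi * real k / real n)"
      using bij_betw_roots_unity[OF n] unfolding U_def bij_betw_def by blast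
    also have "2 * pi * real k / real n = 2 * pi * real (k * p) / real (n * p)"
      using p by simp
    finally have "z = \<eta> ^ (k * p)" by (simp only: \<eta>_pow)
    thus ?thesis using relI[OF rel_\<eta>] by blast
  qed
  have \<rho>_add: "\<rho> (a + b) = \<rho> a + \<rho> b" and \<rho>_mult: "\<rho> (a * b) = \<rho> a * \<rho> b"
    and add_mem: "a + b \<in> \<O>" and mult_mem: "a * b \<in> \<O>" if "a \<in> \<O>" "b \<in> \<O>" for a b
    using relI[OF rel_add] relI[OF rel_mult] relD that by blast+
  have \<rho>1: "\<rho> 1 = 1" and mem1: "1 \<in> \<O>" using relI[OF rel1] by auto
  have \<rho>_pow: "z ^ i \<in> \<O> \<and> \<rho> (z ^ i) = \<rho> z ^ i" if "z \<in> \<O>" for z i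
    by (induction i) (use that mem1 \<rho>1 mult_mem \<rho>_mult in auto)
  \<comment> \<open>For \<open>u \<noteq> 1\<close> the geometric sum of the powers of
    \<open>u\<close> is 0, yet it reduces to \<open>n\<close>, which is -1 in the field.\<close>
  have U_inj: "u = 1" if u: "u \<in> U" "\<rho> u = 1" for u
  proof (rule ccontr)
    assume "u \<noteq> 1"
    hence sum0: "(\<Sum>i<n. u ^ i) = 0" using u(1) by (simp add: geometric_sum U_def)
    have "(\<Sum>i<j. u ^ i) \<in> \<O> \<and> \<rho> (\<Sum>i<j. u ^ i) = of_nat j" if "j > 0" for j
      using that
    proof (induction j)
      case (Suc j)
      thus ?case
        using \<rho>_pow[OF U_mem[OF u(1)], of j] add_mem \<rho>_add mem1 \<rho>1 u(2) by (cases "j = 0") auto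
    qed simp
    from this[OF n] have "\<rho> 0 = of_nat n" by (simp only: sum0)
    moreover have "\<rho> 0 = 0"
      using relI[OF rel_poly[of 0]] by simp
    ultimately have "of_nat n = (0 :: 'a)" by simp
    moreover have "of_nat (n + 1) = (0 :: 'a)"
      using finite_field_CHAR[OF assms] assms(2) card_eq n p
      by (subst of_nat_eq_0_iff_char_dvd) (cases f; simp)
    ultimately show False by simp
  qed
  have inj: "inj_on \<rho> U"
  proof (rule inj_onI)
    fix z w assume zw: "z \<in> U" "w \<in> U" "\<rho> z = \<rho> w"
    have w0: "w \<noteq> 0" using zw(2) n by (auto simp: U_def power_0_left)
    have u: "z / w \<in> U" using zw by (simp add: U_def power_divide)
    have "\<rho> z = \<rho> (z / w) * \<rho> w"
      using \<rho>_mult[OF U_mem[OF u] U_mem[OF zw(2)]] w0 by simp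
    moreover have "\<rho> w \<noteq> 0"
    proof
      assume "\<rho> w = 0"
      hence "\<rho> (w ^ n) = 0" using \<rho>_pow[OF U_mem[OF zw(2)], of n] n by simp
      thus False using zw(2) \<rho>1 by (simp add: U_def)
    qed
    ultimately have "\<rho> (z / w) = 1" using zw(3) by simp
    hence "z / w = 1" by (rule U_inj[OF u])
    thus "z = w" using w0 by simp
  qed
  \<comment> \<open>An injection of \<open>n\<close> roots of unity into the \<open>n\<close>
    nonzero field elements is onto.\<close>
  have im: "\<rho> ` U = UNIV - {0}"
  proof (rule card_subset_eq)
    show "\<rho> ` U \<subseteq> UNIV - {0}"
    proof safe
      fix w assume w: "w \<in> U" "\<rho> w = 0"
      hence "\<rho> (w ^ n) = 0" using \<rho>_pow[OF U_mem[OF w(1)], of n] n by simp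
      thus False using w(1) \<rho>1 by (simp add: U_def)
    qed simp
    show "card (\<rho> ` U) = card (UNIV - {0::'a})"
      using card_image[OF inj] cardU card_eq by simp
  qed simp
  define T where "T x = (if x = 0 then 0 else inv_into U \<rho> x)" for x
  have T_U: "T x \<in> U" "\<rho> (T x) = x" if "x \<noteq> 0" for x
    using that im by (auto simp: T_def inv_into_into f_inv_into_f)
  have T_eq: "T (\<rho> u) = u" if "u \<in> U" for u
    using that im inj by (auto simp: T_def inv_into_f_f)
  have T_mult: "T (x * y) = T x * T y" for x y
  proof (cases "x = 0 \<or> y = 0")
    case False
    hence xy: "T x \<in> U" "T y \<in> U" "\<rho> (T x) = x" "\<rho> (T y) = y" using T_U by auto
    hence "\<rho> (T x * T y) = x * y" using \<rho>_mult U_mem by auto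
    moreover have "T x * T y \<in> U" using xy by (simp add: U_def power_mult_distrib)
    ultimately show ?thesis using T_eq[of "T x * T y"] by simp
  qed (auto simp: T_def)
  define \<zeta> where "\<zeta> = \<eta> ^ n"
  have \<zeta>: "\<zeta> = cis (2 * pi * real 1 / real p)" using n p unfolding \<zeta>_def \<eta>_pow by simp
  have "inj_on (\<lambda>k. cis (2 * pi * real k / real p)) {..<p}"
    using bij_betw_roots_unity[of p] p by (simp add: bij_betw_def)
  from inj_onD[OF this, of 1 0] p have \<zeta>1: "\<zeta> \<noteq> 1" by (auto simp: \<zeta>)
  have \<rho>0: "\<rho> 0 = 0" "0 \<in> \<O>" using relI[OF rel_poly[of 0]] by simp_all
  have "teichmueller p f (p ^ f) \<O> \<rho> T \<zeta>"
  proof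
    show "prime p" "p ^ f = p ^ f" "CARD('a) = p ^ f" "1 \<in> \<O>" "\<rho> 1 = 1"
      using assms mem1 \<rho>1 by auto
    show "- a \<in> \<O>" if "a \<in> \<O>" for a using relI[OF rel_uminus] relD that by blast
    show "inverse a \<in> \<O>" if "a \<in> \<O>" "\<rho> a \<noteq> 0" for a using relI[OF rel_inverse] relD that by blast
    show "T x \<in> \<O>" "\<rho> (T x) = x" for x
      using T_U[of x] U_mem \<rho>0 by (cases "x = 0"; simp add: T_def)+
    show "T 0 = 0" by (simp add: T_def)
    show "\<zeta> \<in> \<O>" using relI[OF rel_\<eta>] by (simp add: \<zeta>_def)
    show "\<zeta> ^ p = 1" using \<eta>1 by (simp add: \<zeta>_def power_mult)
  qed (use add_mem mult_mem \<rho>_add \<rho>_mult T_mult \<zeta>1 in auto)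
  thus thesis by (rule that)
qed

section \<open>Local divisibility\<close>

lemma cis_root_power_eq_1_iff:
  assumes "0 < n"
  shows "cis (2 * pi / real n) ^ k = 1 \<longleftrightarrow> n dvd k"
proof -
  let ?w = "cis (2 * pi / real n)"
  have pow: "?w ^ j = cis (2 * pi * real j / real n)" for j
    by (simp add: DeMoivre mult_ac)
  have "?w ^ n = cis (2 * pi)" using assms by (subst pow) simp
  hence n1: "?w ^ n = 1" by simp
  have "?w ^ k = ?w ^ (n * (k div n) + k mod n)" by simp
  also have "\<dots> = ?w ^ (k mod n)" by (simp only: power_add power_mult n1) simp
  finally have eq: "?w ^ k = ?w ^ (k mod n)" .
  have inj: "inj_on (\<lambda>k. cis (2 * pi * real k / real n)) {..<n}"
    using bij_betw_roots_unity[OF assms] by (simp add: bij_betw_def)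
  show ?thesis
  proof
    assume "?w ^ k = 1"
    hence "cis (2 * pi * real (k mod n) / real n) = cis (2 * pi * real 0 / real n)"
      using eq pow by simp
    from inj_onD[OF inj this] assms show "n dvd k" by auto
  qed (use eq in auto)
qed

lemma sum_power_roots_unity:
  assumes "0 < n"
  shows "(\<Sum>z | z ^ n = 1. z ^ k :: complex) = (if n dvd k then of_nat n else 0)"
proof -
  define w where "w = cis (2 * pi / real n)"
  have "(\<Sum>z | z ^ n = 1. z ^ k :: complex) = (\<Sum>j<n. cis (2 * pi * real j / real n) ^ k)"
    using bij_betw_roots_unity[OF assms] by (rule sum.reindex_bij_betw [symmetric])
  also have "\<dots> = (\<Sum>j<n. (w ^ k) ^ j)"
    by (intro sum.cong refl) (simp add: w_def DeMoivre mult_ac)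
  also have "\<dots> = (if n dvd k then of_nat n else 0)"
  proof (cases "n dvd k")
    case True
    hence "w ^ k = 1" using cis_root_power_eq_1_iff[OF assms] by (simp add: w_def)
    thus ?thesis using True by simp
  next
    case False
    hence "w ^ k \<noteq> 1" using cis_root_power_eq_1_iff[OF assms] by (simp add: w_def)
    moreover have "(w ^ k) ^ n = 1"
      using cis_root_power_eq_1_iff[OF assms, of "k * n"] by (simp add: w_def power_mult)
    ultimately show ?thesis using False by (simp add: geometric_sum)
  qed
  finally show ?thesis .
qed

text \<open>The trace polynomial is nonzero, its linear coefficient being 1, and of degree at most
  \<open>p ^ (e - 1)\<close>, so it cannot vanish on a larger set.\<close>

lemma trace_polynomial_nonzero:
  fixes S :: "'a::field set"
  assumes "1 < p" "0 < e" "finite S" "p ^ (e - 1) < card S"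
  shows "\<exists>y\<in>S. (\<Sum>i<e. y ^ (p ^ i)) \<noteq> 0"
proof (rule ccontr)
  assume none: "\<not> ?thesis"
  define P :: "'a poly" where "P = (\<Sum>i<e. monom 1 (p ^ i))"
  have "coeff P 1 = (\<Sum>i<e. if i = 0 then 1 else 0)"
    unfolding P_def coeff_sum using assms(1) by (intro sum.cong) auto
  hence P0: "P \<noteq> 0" using assms(2) by auto
  have "degree P \<le> p ^ (e - 1)"
    unfolding P_def
  proof (intro degree_sum_le)
    fix i assume "i \<in> {..<e}"
    hence "p ^ i \<le> p ^ (e - 1)" using assms(1) by (intro power_increasing) auto
    thus "degree (monom (1 :: 'a) (p ^ i)) \<le> p ^ (e - 1)"
      using degree_monom_le order_trans by blast
  qed simp
  moreover have "card {x. poly P x = 0} \<le> degree P" using P0 by (rule card_poly_roots_bound)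
  moreover have "S \<subseteq> {x. poly P x = 0}"
    using none by (auto simp: P_def poly_sum poly_monom)
  hence "card S \<le> card {x. poly P x = 0}" using P0 by (intro card_mono poly_roots_finite)
  ultimately show False using assms(4) by linarith
qed

context teichmueller
begin

lemma p_gt_1: "p > 1" and p_pos: "p > 0"
  using prime_p prime_gt_1_nat prime_gt_0_nat by blast+

lemma f_pos: "f > 0"
proof (rule ccontr)
  assume "\<not> f > 0"
  hence "CARD('a) = 1" using card_UNIV Q_eq by simp
  thus False using card_mono[of UNIV "{0,1::'a}"] by simp
qed

lemma Q_gt_1: "Q > 1" using p_gt_1 f_pos unfolding Q_eq by (rule one_less_power)

lemma CHAR_eq: "CHAR('a) = p"
  using finite_field_CHAR[OF prime_p] card_UNIV Q_eq by blast

lemma of_nat_eq_0_iff: "of_nat n = (0 :: 'a) \<longleftrightarrow> p dvd n"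
  by (simp add: of_nat_eq_0_iff_char_dvd CHAR_eq)

lemma zero_mem [simp]: "0 \<in> \<O>"
  using add_mem[OF one_mem uminus_mem[OF one_mem]] by simp

lemma \<rho>_0 [simp]: "\<rho> 0 = 0"
  using \<rho>_add[OF zero_mem zero_mem] by (metis add_0_right add_left_cancel)

lemma \<rho>_uminus [simp]: "a \<in> \<O> \<Longrightarrow> \<rho> (- a) = - \<rho> a"
  using \<rho>_add[of a "- a"] by (simp add: eq_neg_iff_add_eq_0 add.commute)

lemma diff_mem [simp]: "a \<in> \<O> \<Longrightarrow> b \<in> \<O> \<Longrightarrow> a - b \<in> \<O>"
  using add_mem[of a "- b"] by simp

lemma \<rho>_diff [simp]: "a \<in> \<O> \<Longrightarrow> b \<in> \<O> \<Longrightarrow> \<rho> (a - b) = \<rho> a - \<rho> b"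
  using \<rho>_add[of a "- b"] by simp

lemma power_mem [simp]: "a \<in> \<O> \<Longrightarrow> a ^ n \<in> \<O>"
  by (induction n) auto

lemma \<rho>_power [simp]: "a \<in> \<O> \<Longrightarrow> \<rho> (a ^ n) = \<rho> a ^ n"
  by (induction n) auto

lemma sum_mem [simp]: "(\<And>x. x \<in> S \<Longrightarrow> g x \<in> \<O>) \<Longrightarrow> sum g S \<in> \<O>"
  by (induction S rule: infinite_finite_induct) auto

lemma \<rho>_sum: "(\<And>x. x \<in> S \<Longrightarrow> g x \<in> \<O>) \<Longrightarrow> \<rho> (sum g S) = (\<Sum>x\<in>S. \<rho> (g x))"
  by (induction S rule: infinite_finite_induct) auto

lemma prod_mem [simp]: "(\<And>x. x \<in> S \<Longrightarrow> g x \<in> \<O>) \<Longrightarrow> prod g S \<in> \<O>"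
  by (induction S rule: infinite_finite_induct) auto

lemma of_nat_mem [simp]: "of_nat n \<in> \<O>"
  by (induction n) auto

lemma \<rho>_of_nat [simp]: "\<rho> (of_nat n) = of_nat n"
  by (induction n) auto

lemma T_eq_0_iff [simp]: "T x = 0 \<longleftrightarrow> x = 0"
  using \<rho>_T[of x] by (metis T_0 \<rho>_0)

lemma T_1 [simp]: "T 1 = 1"
  using T_mult[of 1 1] by simp

lemma T_power: "T (x ^ n) = T x ^ n"
  by (induction n) (auto simp: T_mult)

lemma T_prod: "T (prod g S) = (\<Prod>x\<in>S. T (g x))"
  by (induction S rule: infinite_finite_induct) (auto simp: T_mult)

lemma inj_T: "inj T"
  by (metis injI \<rho>_T)

lemma T_inverse: "T (inverse x) = inverse (T x)"
proof (cases "x = 0")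
  case False
  hence "T x * T (inverse x) = 1" by (simp flip: T_mult)
  thus ?thesis using inverse_unique by metis
qed simp

lemma pow_Q_minus_1: "x \<noteq> 0 \<Longrightarrow> x ^ (Q - 1) = (1 :: 'a)"
  using finite_field_pow_card_minus_1[of x] card_UNIV by simp

lemma pow_Q: "x ^ Q = (x :: 'a)"
proof (cases "x = 0")
  case False
  have "x ^ Q = x * x ^ (Q - 1)" using Q_gt_1 by (cases Q) auto
  thus ?thesis using pow_Q_minus_1[OF False] by simp
qed (use Q_gt_1 in \<open>auto simp: power_0_left\<close>)

section \<open>Power sums of the Teichmueller character\<close>

lemma bij_T_roots_unity:
  assumes "0 < N" "N dvd Q - 1"
  shows "bij_betw T {x. x ^ N = 1} {z. z ^ N = 1}"
proof -
  have fin: "finite {z :: complex. z ^ (Q - 1) = 1}" using Q_gt_1 by (intro finite_roots_unity) simp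
  have "T ` (UNIV - {0}) = {z. z ^ (Q - 1) = 1}"
  proof (rule card_subset_eq[OF fin])
    show "T ` (UNIV - {0}) \<subseteq> {z. z ^ (Q - 1) = 1}"
      using pow_Q_minus_1 by (auto simp flip: T_power)
    have "card (T ` (UNIV - {0})) = Q - 1"
      using inj_T card_UNIV by (subst card_image) (auto intro: inj_on_subset)
    thus "card (T ` (UNIV - {0})) = card {z :: complex. z ^ (Q - 1) = 1}"
      using Q_gt_1 by (simp add: card_roots_unity_eq)
  qed
  hence surj: "\<exists>x. z = T x" if "z ^ N = 1" for z
  proof -
    from assms(2) obtain M where "Q - 1 = N * M" by (elim dvdE)
    hence "z ^ (Q - 1) = 1" using that by (simp add: power_mult)
    thus ?thesis using \<open>T ` (UNIV - {0}) = _\<close> by blast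
  qed
  have iff: "T x ^ N = 1 \<longleftrightarrow> x ^ N = 1" for x
    using inj_T by (metis T_1 T_power injD)
  show ?thesis
    unfolding bij_betw_def using inj_T surj iff by (auto intro: inj_on_subset)
qed

lemma sum_T_power_roots_unity:
  assumes "0 < N" "N dvd Q - 1"
  shows "(\<Sum>x | x ^ N = 1. T x ^ k) = (if N dvd k then of_nat N else 0)"
  using sum.reindex_bij_betw[OF bij_T_roots_unity[OF assms], of "\<lambda>z. z ^ k"]
    sum_power_roots_unity[OF assms(1)] by simp

lemma nonzero_eq_roots_unity: "UNIV - {0} = {x :: 'a. x ^ (Q - 1) = 1}"
  using pow_Q_minus_1 Q_gt_1 by (auto simp: power_0_left)

lemma sum_T_power: "(\<Sum>x\<in>UNIV-{0}. T x ^ k) = (if Q - 1 dvd k then of_nat (Q - 1) else 0)"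
  using sum_T_power_roots_unity[of "Q - 1" k] Q_gt_1 by (simp add: nonzero_eq_roots_unity)

lemma sum_nonzero_inverse: "(\<Sum>x\<in>UNIV-{0}. g (inverse x)) = (\<Sum>x\<in>UNIV-{0::'a}. g x)"
  by (rule sum.reindex_bij_witness[of _ inverse inverse]) auto

lemma of_nat_Q_minus_1: "of_nat (Q - 1) = (- 1 :: 'a)"
proof -
  have "Q - 1 + 1 = p ^ f" using Q_gt_1 Q_eq by simp
  hence "of_nat (Q - 1 + 1) = (0 :: 'a)"
    using f_pos by (simp only: of_nat_eq_0_iff) (simp add: dvd_power)
  thus ?thesis by (simp only: of_nat_add of_nat_1 eq_neg_iff_add_eq_0)
qed

text \<open>The complex power sum is reduced by \<open>\<rho>\<close>, under which
  \<open>Q - 1\<close> becomes -1.\<close>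

lemma sum_power_field: "(\<Sum>x\<in>UNIV-{0::'a}. x ^ k) = (if Q - 1 dvd k then - 1 else 0)"
proof -
  have "(\<Sum>x\<in>UNIV-{0::'a}. x ^ k) = \<rho> (\<Sum>x\<in>UNIV-{0}. T x ^ k)"
    by (subst \<rho>_sum) auto
  thus ?thesis using of_nat_Q_minus_1 by (simp add: sum_T_power del: of_nat_diff)
qed

section \<open>Divisibility in \<open>\<O>\<close>, used in place of a valuation function\<close>

definition loc_dvd :: "complex \<Rightarrow> complex \<Rightarrow> bool" (infix "\<preceq>" 50)
  where "a \<preceq> b \<longleftrightarrow> (\<exists>c\<in>\<O>. b = a * c)"

lemma loc_dvd_refl [simp]: "a \<preceq> a"
  unfolding loc_dvd_def by (intro bexI[of _ 1]) auto

lemma loc_dvd_trans [trans]: "a \<preceq> b \<Longrightarrow> b \<preceq> c \<Longrightarrow> a \<preceq> c"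
  unfolding loc_dvd_def by (metis mult.assoc mult_mem)

lemma loc_dvd_mult_right: "a \<preceq> b \<Longrightarrow> c \<in> \<O> \<Longrightarrow> a \<preceq> b * c"
  unfolding loc_dvd_def by (metis mult.assoc mult_mem)

lemma loc_dvd_mult_left: "a \<preceq> b \<Longrightarrow> c \<in> \<O> \<Longrightarrow> a \<preceq> c * b"
  using loc_dvd_mult_right by (simp add: mult.commute)

lemma loc_dvd_mult_mono:
  assumes "a \<preceq> b" "c \<preceq> d"
  shows "a * c \<preceq> b * d"
proof -
  from assms obtain x y where xy: "x \<in> \<O>" "y \<in> \<O>" "b = a * x" "d = c * y"
    unfolding loc_dvd_def by blast
  hence "b * d = (a * c) * (x * y)" by simp
  thus ?thesis unfolding loc_dvd_def using xy mult_mem by blast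
qed

lemma loc_dvd_prod: "(\<And>i. i \<in> S \<Longrightarrow> g i \<preceq> h i) \<Longrightarrow> prod g S \<preceq> prod h S"
  by (induction S rule: infinite_finite_induct) (auto intro: loc_dvd_mult_mono)

lemma loc_dvd_0 [simp]: "a \<preceq> 0"
  unfolding loc_dvd_def by (intro bexI[of _ 0]) auto

lemma loc_dvd_add:
  assumes "a \<preceq> b" "a \<preceq> c"
  shows "a \<preceq> b + c"
proof -
  from assms obtain x y where xy: "x \<in> \<O>" "y \<in> \<O>" "b = a * x" "c = a * y"
    unfolding loc_dvd_def by blast
  hence "b + c = a * (x + y)" by (simp add: algebra_simps)
  thus ?thesis unfolding loc_dvd_def using xy add_mem by blast
qed

lemma loc_dvd_sum: "(\<And>i. i \<in> S \<Longrightarrow> a \<preceq> g i) \<Longrightarrow> a \<preceq> sum g S"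
  by (induction S rule: infinite_finite_induct) (auto intro: loc_dvd_add)

lemma loc_dvd_uminus: "a \<preceq> b \<Longrightarrow> a \<preceq> - b"
  using loc_dvd_mult_left[of a b "- 1"] by simp

definition loc_unit :: "complex \<Rightarrow> bool"
  where "loc_unit u \<longleftrightarrow> u \<in> \<O> \<and> \<rho> u \<noteq> 0"

lemma loc_unit_nonzero: "loc_unit u \<Longrightarrow> u \<noteq> 0"
  by (auto simp: loc_unit_def)

lemma loc_unit_inverse_mem: "loc_unit u \<Longrightarrow> inverse u \<in> \<O>"
  by (simp add: loc_unit_def inverse_mem)

lemma loc_unit_power: "loc_unit u \<Longrightarrow> loc_unit (u ^ n)"
  by (simp add: loc_unit_def)

lemma loc_dvd_cancel_unit: "loc_unit u \<Longrightarrow> a \<preceq> u * b \<Longrightarrow> a \<preceq> b"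
  using loc_dvd_mult_left[of a "u * b" "inverse u"] loc_unit_inverse_mem loc_unit_nonzero
  by (simp flip: mult.assoc)

text \<open>After cancelling the exact power of \<open>p\<close> in \<open>w\<close>, an integer
  prime to \<open>p\<close> would be a multiple of \<open>p\<close> in \<open>\<O>\<close> and
  reduce to 0.\<close>

lemma loc_dvd_nat_imp_dvd:
  assumes "of_nat (p ^ t) \<preceq> of_nat w"
  shows "p ^ t dvd w"
proof (rule ccontr)
  assume nd: "\<not> p ^ t dvd w"
  hence w0: "w \<noteq> 0" by (metis dvd_0_right)
  define a where "a = multiplicity p w"
  have "\<not> is_unit p" using p_gt_1 by simp
  from multiplicity_decompose'[OF w0 this] obtain v where v: "w = p ^ a * v" "\<not> p dvd v"
    unfolding a_def by metis
  have "a < t" using nd v(1) by (metis dvd_triv_left le_imp_power_dvd dvd_trans not_le)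
  then obtain b where b: "t = a + Suc b" using less_imp_Suc_add by auto
  from assms obtain c where c: "c \<in> \<O>" "of_nat w = of_nat (p ^ t) * c"
    unfolding loc_dvd_def by blast
  have "of_nat (p ^ a) * of_nat v = of_nat (p ^ a) * (of_nat p ^ Suc b * c)"
    using c(2) unfolding v(1) b by (simp only: of_nat_mult of_nat_power power_add mult.assoc)
  hence "of_nat v = of_nat p ^ Suc b * c"
    by (subst (asm) mult_cancel_left) (use p_pos in simp)
  hence "\<rho> (of_nat v) = \<rho> (of_nat p ^ Suc b * c)" by simp
  also have "\<dots> = 0" using c(1) of_nat_eq_0_iff[of p] by simp
  finally show False using v(2) by (simp add: of_nat_eq_0_iff)
qed

section \<open>The uniformizer and its relation to \<open>p\<close>\<close>

definition unif :: complex where "unif = \<zeta> - 1"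

text \<open>In characteristic \<open>p\<close> the only \<open>p\<close>-th root of 1 is 1, because
  \<open>(x - 1) ^ p = x ^ p - 1\<close>.\<close>

lemma \<rho>_\<zeta> [simp]: "\<rho> \<zeta> = 1"
proof -
  have "(\<rho> \<zeta> - 1 + 1) ^ p = (\<rho> \<zeta> - 1) ^ p + 1 ^ p"
    by (rule freshmans_dream) (use CHAR_eq prime_p in auto)
  moreover have "\<rho> \<zeta> ^ p = 1" using \<zeta>_pow_p \<rho>_power[OF \<zeta>_mem, of p] by simp
  ultimately show ?thesis using p_pos by simp
qed

lemma unif_mem [simp]: "unif \<in> \<O>" and \<rho>_unif [simp]: "\<rho> unif = 0" and unif_nonzero [simp]: "unif \<noteq> 0"
  using \<zeta>_neq_1 by (auto simp: unif_def)

text \<open>In the binomial expansion of \<open>(unif + 1) ^ p = 1\<close> all inner coefficients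
  are divisible by \<open>p\<close>; removing one factor \<open>unif\<close> leaves
  \<open>unif ^ (p - 1) = - v * p\<close>.\<close>

lemma p_eq_unif_power: "\<exists>u. loc_unit u \<and> of_nat p = u * unif ^ (p - 1)"
proof -
  define d where "d k = (p choose k) div p" for k
  have d: "p choose k = p * d k" if "k \<in> {1..<p}" for k
    using that prime_p by (auto simp: d_def dvd_choose_prime)
  define v where "v = (\<Sum>k\<in>{1..<p}. of_nat (d k) * unif ^ (k - 1))"
  have split: "{..p} = insert 0 (insert p {1..<p})" using p_pos by auto
  have "1 = (unif + 1) ^ p" using \<zeta>_pow_p by (simp add: unif_def)
  also have "\<dots> = (\<Sum>k\<le>p. of_nat (p choose k) * unif ^ k)"
    by (simp add: binomial_ring)
  also have "\<dots> = 1 + (unif ^ p + (\<Sum>k\<in>{1..<p}. of_nat (p choose k) * unif ^ k))"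
    unfolding split using p_pos by simp
  also have "(\<Sum>k\<in>{1..<p}. of_nat (p choose k) * unif ^ k) =
      (\<Sum>k\<in>{1..<p}. of_nat p * unif * (of_nat (d k) * unif ^ (k - 1)))"
  proof (intro sum.cong refl)
    fix k assume k: "k \<in> {1..<p}"
    hence "unif ^ k = unif * unif ^ (k - 1)" by (cases k) auto
    thus "of_nat (p choose k) * unif ^ k = of_nat p * unif * (of_nat (d k) * unif ^ (k - 1))"
      using d[OF k] by simp
  qed
  also have "\<dots> = of_nat p * unif * v" by (simp add: v_def sum_distrib_left)
  finally have "unif ^ p + of_nat p * unif * v = 0" by simp
  moreover have "unif ^ p = unif * unif ^ (p - 1)" using p_pos by (cases p) auto
  ultimately have "unif * (unif ^ (p - 1) + of_nat p * v) = 0" by (simp add: algebra_simps)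
  hence eq: "unif ^ (p - 1) = - v * of_nat p" by (simp add: eq_neg_iff_add_eq_0 mult.commute)
  \<comment> \<open>Only \<open>k = 1\<close> survives, since \<open>unif\<close> reduces to 0; its
    coefficient \<open>d 1\<close> is 1.\<close>
  have "\<rho> v = (\<Sum>k\<in>{1..<p}. if k = 1 then 1 else 0)"
    unfolding v_def
  proof (subst \<rho>_sum, simp, intro sum.cong refl)
    fix k assume k: "k \<in> {1..<p}"
    show "\<rho> (of_nat (d k) * unif ^ (k - 1)) = (if k = 1 then 1 else 0)"
      using k p_pos by (auto simp: d_def power_0_left)
  qed
  also have "\<dots> = 1" using p_gt_1 by simp
  finally have "\<rho> v = 1" .
  moreover have "v \<in> \<O>" unfolding v_def by simp
  ultimately have v: "loc_unit (- v)" by (simp add: loc_unit_def)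
  have "loc_unit (inverse (- v))"
  proof -
    have "\<rho> (- v * inverse (- v)) = 1" using loc_unit_nonzero[OF v] by simp
    hence "\<rho> (inverse (- v)) \<noteq> 0"
      using loc_unit_inverse_mem[OF v] v by (metis \<rho>_mult loc_unit_def mult_zero_right zero_neq_one)
    thus ?thesis using loc_unit_inverse_mem[OF v] by (simp add: loc_unit_def)
  qed
  moreover have "of_nat p = inverse (- v) * unif ^ (p - 1)"
    using eq loc_unit_nonzero[OF v] by (simp add: field_simps)
  ultimately show ?thesis by blast
qed

lemma p_power_eq_unif_power: "\<exists>u. loc_unit u \<and> of_nat (p ^ t) = u * unif ^ (t * (p - 1))"
proof -
  obtain u where "loc_unit u" "of_nat p = u * unif ^ (p - 1)" using p_eq_unif_power by blast
  thus ?thesis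
    by (intro exI[of _ "u ^ t"])
      (simp add: loc_unit_power power_mult_distrib mult.commute flip: power_mult)
qed

end

section \<open>Gauss sums\<close>

declare digit_sum.simps [simp del]

lemma digit_sum_0 [simp]: "digit_sum p 0 = 0"
  by (simp add: digit_sum.simps)

lemma digit_sum_rec: "1 < p \<Longrightarrow> digit_sum p a = a mod p + digit_sum p (a div p)"
  by (cases "a = 0") (auto simp: digit_sum.simps[of p a])

lemma digit_sum_mult: "1 < p \<Longrightarrow> digit_sum p (p * a) = digit_sum p a"
  by (subst digit_sum_rec) auto

lemma digit_sum_Suc:
  assumes "1 < p" "\<not> p dvd Suc a"
  shows "digit_sum p (Suc a) = Suc (digit_sum p a)"
proof -
  have "Suc a mod p = Suc (a mod p)" "Suc a div p = a div p"
    using assms by (auto simp: mod_Suc div_Suc dvd_eq_mod_eq_0)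
  thus ?thesis using digit_sum_rec[OF assms(1), of a] digit_sum_rec[OF assms(1), of "Suc a"] by simp
qed

text \<open>All \<open>n\<close> digits of \<open>p ^ n - 1\<close> equal \<open>p - 1\<close>, so
  subtracting \<open>r\<close> from it involves no borrow.\<close>

lemma digit_sum_complement:
  assumes "1 < p" "r \<le> p ^ n - 1"
  shows "digit_sum p r + digit_sum p (p ^ n - 1 - r) = n * (p - 1)"
  using assms(2)
proof (induction n arbitrary: r)
  case (Suc n)
  define a b where "a = r mod p" and "b = r div p"
  define r' where "r' = p ^ Suc n - 1 - r"
  have r: "r = p * b + a" and a: "a < p" using assms(1) by (auto simp: a_def b_def)
  have "0 < p * p ^ n" using assms(1) by simp
  hence r_less: "r < p * p ^ n" using Suc.prems unfolding power_Suc by linarith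
  hence "b < p ^ n" unfolding b_def by (intro less_mult_imp_div_less) (simp only: mult.commute)
  then obtain c where c: "p ^ n = Suc (b + c)" using less_imp_Suc_add by blast
  have "p * p ^ n = p * b + p * c + p" unfolding c by (simp add: distrib_left)
  hence "r' = p * c + (p - 1 - a)" using a r unfolding r'_def power_Suc by linarith
  moreover have "p - 1 - a < p" using assms(1) by linarith
  ultimately have r': "r' mod p = p - 1 - a" "r' div p = c" by simp_all
  have "p ^ n - 1 - b = c" "b \<le> p ^ n - 1" unfolding c by simp_all
  hence "digit_sum p b + digit_sum p c = n * (p - 1)" using Suc.IH[of b] by simp
  moreover have "digit_sum p r = a + digit_sum p b"
    unfolding a_def b_def by (rule digit_sum_rec[OF assms(1)])
  moreover have "digit_sum p r' = (p - 1 - a) + digit_sum p c"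
    using digit_sum_rec[OF assms(1), of r'] unfolding r' .
  ultimately have "digit_sum p r + digit_sum p r' = Suc n * (p - 1)" using a by simp
  thus ?case by (simp only: r'_def)
qed simp

text \<open>\<open>p\<close> is congruent to 1 modulo \<open>p - 1\<close>. This later makes the
  minimal total digit sum a multiple of \<open>p - 1\<close>.\<close>

lemma digit_sum_cong:
  assumes "1 < p"
  shows "[digit_sum p a = a] (mod (p - 1))"
proof (induction a rule: less_induct)
  case (less a)
  show ?case
  proof (cases "a = 0")
    case False
    have IH: "[digit_sum p (a div p) = a div p] (mod (p - 1))"
      using assms False by (intro less.IH) auto
    obtain k where "p = Suc (1 + k)" using less_imp_Suc_add[OF assms] by blast
    hence "[1 = p] (mod (p - 1))" by (auto simp: cong_def mod_Suc)
    hence "[a mod p + 1 * digit_sum p (a div p) = a mod p + p * (a div p)] (mod (p - 1))"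
      by (intro cong_add cong_mult cong_refl IH)
    moreover have "digit_sum p a = a mod p + 1 * digit_sum p (a div p)"
      unfolding mult_1 by (rule digit_sum_rec[OF assms])
    ultimately show ?thesis by (metis add.commute mult_div_mod_eq)
  qed simp
qed

context teichmueller
begin

section \<open>The prime field, the absolute trace and the additive character\<close>

lemma frob_of_nat: "of_nat n ^ p = (of_nat n :: 'a)"
proof (induction n)
  case (Suc n)
  have "(of_nat n + 1 :: 'a) ^ p = of_nat n ^ p + 1 ^ p"
    by (rule freshmans_dream) (use CHAR_eq prime_p in auto)
  thus ?case using Suc by (simp add: add.commute)
qed (use p_pos in \<open>simp add: power_0_left\<close>)

lemma of_nat_eq_iff_mod: "(of_nat i :: 'a) = of_nat j \<longleftrightarrow> i mod p = j mod p"
  by (simp add: of_nat_eq_iff_cong_CHAR CHAR_eq cong_def)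

text \<open>The \<open>p\<close> distinct elements of the prime field already exhaust the roots of
  \<open>X ^ p - X\<close>.\<close>

lemma frob_fixed_imp_of_nat:
  assumes "y ^ p = (y :: 'a)"
  shows "\<exists>j<p. of_nat j = y"
proof -
  define P :: "'a poly" where "P = monom 1 p - [:0, 1:]"
  have "degree P = p"
    unfolding P_def diff_conv_add_uminus using p_gt_1
    by (subst degree_add_eq_left) (auto simp: degree_monom_eq)
  hence P0: "P \<noteq> 0" using p_gt_1 by auto
  have fin: "finite {x. poly P x = 0}" using P0 by (rule poly_roots_finite)
  have sub: "of_nat ` {..<p} \<subseteq> {x. poly P x = 0}"
    using frob_of_nat by (auto simp: P_def poly_monom)
  have "card (of_nat ` {..<p} :: 'a set) = p"
    by (subst card_image) (simp_all add: inj_on_def of_nat_eq_iff_mod)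
  moreover have "card {x. poly P x = 0} \<le> p"
    using card_poly_roots_bound[OF P0] \<open>degree P = p\<close> by simp
  ultimately have eq: "of_nat ` {..<p} = {x. poly P x = 0}"
    using card_mono[OF fin sub] by (intro card_subset_eq[OF fin sub]) linarith
  have "y \<in> {x. poly P x = 0}" using assms by (simp add: P_def poly_monom)
  hence "y \<in> of_nat ` {..<p}" by (simp only: eq)
  thus ?thesis by blast
qed

definition tr :: "'a \<Rightarrow> 'a" where "tr x = (\<Sum>i<f. x ^ (p ^ i))"

lemma frob_add_iter: "(x + y :: 'a) ^ (p ^ i) = x ^ (p ^ i) + y ^ (p ^ i)"
  by (rule freshmans_dream') (use CHAR_eq prime_p in auto)

lemma tr_add: "tr (x + y) = tr x + tr y"
  by (simp add: tr_def frob_add_iter sum.distrib)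

lemma tr_frob: "tr (x ^ p) = tr x"
proof -
  have "tr (x ^ p) = (\<Sum>i<f. x ^ (p ^ Suc i))"
    by (simp add: tr_def flip: power_mult)
  also have "\<dots> = (\<Sum>i<Suc f. x ^ (p ^ i)) - x"
    by (subst sum.lessThan_Suc_shift) simp
  also have "\<dots> = tr x" using pow_Q[of x] by (simp add: tr_def Q_eq)
  finally show ?thesis .
qed

lemma frob_tr: "tr x ^ p = tr x"
proof -
  have "tr x ^ p = (\<Sum>i<f. (x ^ (p ^ i)) ^ p)"
    unfolding tr_def by (rule freshmans_dream_sum) (use CHAR_eq prime_p in auto)
  also have "\<dots> = tr (x ^ p)"
    by (simp add: tr_def mult.commute flip: power_mult)
  finally show ?thesis by (simp add: tr_frob)
qed

text \<open>A natural number representing the absolute trace, which lies in the prime field. Only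
  its residue modulo \<open>p\<close> affects \<open>\<zeta> ^ trn x\<close>.\<close>

definition trn :: "'a \<Rightarrow> nat" where "trn x = (SOME j. of_nat j = tr x)"

lemma of_nat_trn: "of_nat (trn x) = tr x"
proof -
  have "\<exists>j. of_nat j = tr x" using frob_fixed_imp_of_nat[OF frob_tr] by blast
  thus ?thesis unfolding trn_def by (rule someI_ex)
qed

definition \<psi> :: "'a \<Rightarrow> complex" where "\<psi> x = \<zeta> ^ trn x"

lemma \<zeta>_power_mod: "\<zeta> ^ (i mod p) = \<zeta> ^ i"
proof -
  have "\<zeta> ^ i = \<zeta> ^ (p * (i div p) + i mod p)" by simp
  also have "\<dots> = \<zeta> ^ (i mod p)" by (simp only: power_add power_mult \<zeta>_pow_p) simp
  finally show ?thesis by simp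
qed

lemma \<zeta>_power_eq_1_iff: "\<zeta> ^ i = 1 \<longleftrightarrow> p dvd i"
proof
  assume i: "\<zeta> ^ i = 1"
  show "p dvd i"
  proof (rule ccontr)
    assume "\<not> p dvd i"
    hence "coprime i p" using prime_p by (metis coprime_commute prime_imp_coprime_nat)
    then obtain a b where "a * i = b * p + 1"
      using coprime_bezout_strong[of i p] p_gt_1 by (metis mult.commute nat_neq_iff)
    hence "(\<zeta> ^ i) ^ a = (\<zeta> ^ p) ^ b * \<zeta>"
      by (metis mult.commute power_add power_mult power_one_right)
    thus False using i \<zeta>_pow_p \<zeta>_neq_1 by simp
  qed
next
  assume "p dvd i"
  thus "\<zeta> ^ i = 1" using \<zeta>_pow_p by (auto simp: power_mult)
qed

lemma \<zeta>_power_cong: "(of_nat i :: 'a) = of_nat j \<Longrightarrow> \<zeta> ^ i = \<zeta> ^ j"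
  by (metis of_nat_eq_iff_mod \<zeta>_power_mod)

lemma \<psi>_mem [simp]: "\<psi> x \<in> \<O>"
  by (simp add: \<psi>_def)

lemma \<psi>_add: "\<psi> (x + y) = \<psi> x * \<psi> y"
proof -
  have "\<zeta> ^ trn (x + y) = \<zeta> ^ (trn x + trn y)"
    by (rule \<zeta>_power_cong) (simp add: of_nat_trn tr_add)
  thus ?thesis by (simp add: \<psi>_def power_add)
qed

lemma \<psi>_eq_1_iff: "\<psi> x = 1 \<longleftrightarrow> tr x = 0"
  unfolding \<psi>_def \<zeta>_power_eq_1_iff using of_nat_eq_0_iff[of "trn x"] of_nat_trn by simp

lemma tr_0 [simp]: "tr 0 = 0"
  using p_pos by (simp add: tr_def power_0_left)

lemma \<psi>_0 [simp]: "\<psi> 0 = 1"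
  by (simp add: \<psi>_eq_1_iff)

lemma \<psi>_sum: "\<psi> (sum g S) = (\<Prod>x\<in>S. \<psi> (g x))"
  by (induction S rule: infinite_finite_induct) (auto simp: \<psi>_add)

lemma \<psi>_frob: "\<psi> (x ^ p) = \<psi> x"
  unfolding \<psi>_def by (rule \<zeta>_power_cong) (simp add: of_nat_trn tr_frob)

text \<open>Translation by \<open>y\<close> permutes \<open>S\<close> and multiplies the sum by
  \<open>\<psi> (y * c)\<close>, a factor different from 1.\<close>

lemma sum_\<psi>_subgroup:
  assumes "finite S" "\<And>x y. x \<in> S \<Longrightarrow> y \<in> S \<Longrightarrow> x + y \<in> S"
    "\<And>x. x \<in> S \<Longrightarrow> - x \<in> S" "y \<in> S" "\<psi> (y * c) \<noteq> 1"
  shows "(\<Sum>x\<in>S. \<psi> (x * c)) = 0"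
proof -
  have "a - y \<in> S" if "a \<in> S" for a
    using assms(2)[OF that assms(3)[OF assms(4)]] by simp
  hence "(\<Sum>x\<in>S. \<psi> (x * c)) = (\<Sum>x\<in>S. \<psi> ((x + y) * c))"
    by (intro sum.reindex_bij_witness[of _ "\<lambda>x. x + y" "\<lambda>x. x - y"])
      (use assms(2,4) in auto)
  also have "\<dots> = (\<Sum>x\<in>S. \<psi> (x * c)) * \<psi> (y * c)"
    by (simp add: \<psi>_add distrib_right sum_distrib_right)
  finally show ?thesis using assms(5) by simp
qed

lemma sum_\<psi>: "(\<Sum>x\<in>UNIV. \<psi> x) = 0"
proof -
  have "p ^ (f - 1) < p ^ f" using f_pos p_gt_1 by (intro power_strict_increasing) auto
  hence "p ^ (f - 1) < card (UNIV :: 'a set)" using card_UNIV Q_eq by simp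
  from trace_polynomial_nonzero[OF p_gt_1 f_pos _ this] obtain y :: 'a where "tr y \<noteq> 0"
    by (auto simp: tr_def)
  thus ?thesis using sum_\<psi>_subgroup[of UNIV y 1] by (simp add: \<psi>_eq_1_iff)
qed

text \<open>The Gauss sum of the multiplicative character \<open>T\<close> to the power
  \<open>- r\<close>. With the inverse, the valuation is the digit sum of \<open>r\<close> itself
  and not of its complement.\<close>

definition gauss :: "nat \<Rightarrow> complex" where
  "gauss r = (\<Sum>x\<in>UNIV-{0}. \<psi> x * T (inverse x) ^ r)"

lemma gauss_mem [simp]: "gauss r \<in> \<O>"
  by (simp add: gauss_def)

lemma sum_nonzero: "(\<Sum>x\<in>UNIV-{0}. g x) = (\<Sum>x\<in>UNIV. g x) - (g (0::'a) :: complex)"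
  by (simp add: sum_diff1)

lemma gauss_multiple:
  assumes "Q - 1 dvd r"
  shows "gauss r = - 1"
proof -
  have "T (inverse x) ^ r = 1" if "x \<noteq> 0" for x
  proof -
    have "inverse x ^ (Q - 1) = 1" using that pow_Q_minus_1[of "inverse x"] by simp
    thus ?thesis using assms by (auto simp: power_mult simp flip: T_power)
  qed
  hence "gauss r = (\<Sum>x\<in>UNIV-{0}. \<psi> x)" by (simp add: gauss_def)
  thus ?thesis by (simp add: sum_nonzero sum_\<psi>)
qed

lemma twisted_gauss:
  "(\<Sum>x\<in>UNIV-{0}. \<psi> (x * a) * T (inverse x) ^ n) =
    (if a \<noteq> 0 then T a ^ n * gauss n else if Q - 1 dvd n then of_nat (Q - 1) else 0)"
proof (cases "a = 0")
  case False
  have "(\<Sum>x\<in>UNIV-{0}. \<psi> (x * a) * T (inverse x) ^ n) =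
      (\<Sum>x\<in>UNIV-{0}. \<psi> x * T (inverse (x / a)) ^ n)"
    by (rule sum.reindex_bij_witness[of _ "\<lambda>x. x / a" "\<lambda>x. x * a"]) (use False in auto)
  also have "\<dots> = T a ^ n * gauss n"
    unfolding gauss_def sum_distrib_left
    by (intro sum.cong refl)
      (simp add: divide_inverse T_mult power_mult_distrib mult.left_commute mult.commute)
  finally show ?thesis using False by simp
next
  case True
  thus ?thesis
    using sum_nonzero_inverse[of "\<lambda>x. T x ^ n"] sum_T_power[of n] by simp
qed

text \<open>Substituting \<open>y = x * t\<close> turns the product into twisted Gauss sums with
  parameter \<open>1 + t\<close>. The value \<open>t = - 1\<close> stands apart because the additive
  character becomes trivial there.\<close>

lemma gauss_mult:
  "gauss r * gauss s = (\<Sum>t\<in>UNIV-{0}. T (inverse t) ^ s *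
    (if t \<noteq> - 1 then T (1 + t) ^ (r + s) * gauss (r + s)
     else if Q - 1 dvd r + s then of_nat (Q - 1) else 0))"
proof -
  have "gauss r * gauss s =
      (\<Sum>x\<in>UNIV-{0}. \<Sum>y\<in>UNIV-{0}. \<psi> (x + y) * T (inverse x) ^ r * T (inverse y) ^ s)"
    by (simp add: gauss_def sum_product \<psi>_add mult_ac)
  also have "\<dots> = (\<Sum>x\<in>UNIV-{0}. \<Sum>t\<in>UNIV-{0}.
      T (inverse t) ^ s * (\<psi> (x * (1 + t)) * T (inverse x) ^ (r + s)))"
  proof (rule sum.cong[OF refl])
    fix x :: 'a assume x: "x \<in> UNIV - {0}"
    have "(\<Sum>y\<in>UNIV-{0}. \<psi> (x + y) * T (inverse x) ^ r * T (inverse y) ^ s) =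
        (\<Sum>t\<in>UNIV-{0}. \<psi> (x + x * t) * T (inverse x) ^ r * T (inverse (x * t)) ^ s)"
      by (rule sum.reindex_bij_witness[of _ "\<lambda>t. x * t" "\<lambda>y. y / x"]) (use x in auto)
    also have "\<dots> = (\<Sum>t\<in>UNIV-{0}. T (inverse t) ^ s * (\<psi> (x * (1 + t)) * T (inverse x) ^ (r + s)))"
      by (intro sum.cong refl)
        (simp add: T_mult power_mult_distrib power_add distrib_left mult_ac)
    finally show "(\<Sum>y\<in>UNIV-{0}. \<psi> (x + y) * T (inverse x) ^ r * T (inverse y) ^ s) =
        (\<Sum>t\<in>UNIV-{0}. T (inverse t) ^ s * (\<psi> (x * (1 + t)) * T (inverse x) ^ (r + s)))" .
  qed
  also have "\<dots> = (\<Sum>t\<in>UNIV-{0}. T (inverse t) ^ s *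
      (\<Sum>x\<in>UNIV-{0}. \<psi> (x * (1 + t)) * T (inverse x) ^ (r + s)))"
    by (subst sum.swap) (simp add: sum_distrib_left)
  also have "\<dots> = (\<Sum>t\<in>UNIV-{0}. T (inverse t) ^ s *
    (if t \<noteq> - 1 then T (1 + t) ^ (r + s) * gauss (r + s)
     else if Q - 1 dvd r + s then of_nat (Q - 1) else 0))"
    unfolding twisted_gauss by (intro sum.cong refl) (simp add: eq_neg_iff_add_eq_0 add.commute)
  finally show ?thesis .
qed

text \<open>The ordinary terms of \<open>gauss_mult\<close> all contain
  \<open>gauss (r + s)\<close>, their cofactors forming a Jacobi sum in \<open>\<O>\<close>. The
  assumption makes the exceptional term at \<open>t = - 1\<close> vanish.\<close>

lemma gauss_add_dvd:
  assumes "\<not> Q - 1 dvd r + s"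
  shows "gauss (r + s) \<preceq> gauss r * gauss s"
  unfolding gauss_mult
proof (rule loc_dvd_sum)
  fix t :: 'a
  show "gauss (r + s) \<preceq> T (inverse t) ^ s *
    (if t \<noteq> - 1 then T (1 + t) ^ (r + s) * gauss (r + s)
     else if Q - 1 dvd r + s then of_nat (Q - 1) else 0)"
    using assms by (auto intro!: loc_dvd_mult_left)
qed

text \<open>Since \<open>gauss (Q - 1) = - 1\<close>, each ordinary term of
  \<open>gauss_mult\<close> is \<open>- (T (inverse t) ^ s)\<close>. Splitting the exceptional
  factor \<open>Q - 1\<close> as \<open>Q\<close> minus 1 completes these to a full character sum,
  which vanishes.\<close>

lemma gauss_complement:
  assumes "0 < s" "s < Q - 1"
  shows "gauss (Q - 1 - s) * gauss s = T (- 1) ^ s * of_nat Q"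
proof -
  have ns: "\<not> Q - 1 dvd s" using assms by (auto dest: dvd_imp_le)
  have eq: "Q - 1 - s + s = Q - 1" using assms by simp
  have unit: "T (1 + t) ^ (Q - 1) = 1" if "t \<noteq> - 1" for t
    using that pow_Q_minus_1[of "1 + t"] by (simp add: eq_neg_iff_add_eq_0 add.commute flip: T_power)
  have "gauss (Q - 1 - s) * gauss s =
      (\<Sum>t\<in>UNIV-{0}. T (inverse t) ^ s * (if t = - 1 then of_nat Q else 0) - T (inverse t) ^ s)"
    unfolding gauss_mult eq using gauss_multiple[of "Q - 1"] unit Q_gt_1
    by (intro sum.cong refl) (auto simp: of_nat_diff algebra_simps)
  also have "\<dots> = (\<Sum>t\<in>UNIV-{0}. if t = - 1 then T (inverse t) ^ s * of_nat Q else 0)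
      - (\<Sum>t\<in>UNIV-{0}. T (inverse t) ^ s)"
    unfolding sum_subtractf by (intro arg_cong2[of _ _ _ _ "(-)"] sum.cong refl) auto
  also have "\<dots> = T (- 1) ^ s * of_nat Q"
    using sum_nonzero_inverse[of "\<lambda>x. T x ^ s"] sum_T_power[of s] ns by simp
  finally show ?thesis .
qed

text \<open>The Frobenius map permutes the nonzero elements and leaves \<open>\<psi>\<close>
  unchanged.\<close>

lemma gauss_mult_p: "gauss (p * r) = gauss r"
proof -
  have "inj (\<lambda>x::'a. x ^ p)"
  proof (rule injI)
    fix x y :: 'a assume xy: "x ^ p = y ^ p"
    have "(x - y + y) ^ p = (x - y) ^ p + y ^ p"
      by (rule freshmans_dream) (use CHAR_eq prime_p in auto)
    thus "x = y" using xy by simp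
  qed
  moreover from this have "surj (\<lambda>x::'a. x ^ p)" by (simp add: finite_UNIV_inj_surj)
  ultimately have "bij_betw (\<lambda>x::'a. x ^ p) UNIV UNIV" by (simp add: bij_betw_def)
  hence "bij_betw (\<lambda>x::'a. x ^ p) (UNIV - {0}) (UNIV - {0 ^ p})"
    by (intro bij_betw_DiffI) (auto simp: bij_betw_def)
  hence bij: "bij_betw (\<lambda>x::'a. x ^ p) (UNIV - {0}) (UNIV - {0})"
    using p_pos by (simp add: power_0_left)
  have "gauss r = (\<Sum>x\<in>UNIV-{0}. \<psi> (x ^ p) * T (inverse (x ^ p)) ^ r)"
    unfolding gauss_def by (rule sum.reindex_bij_betw[OF bij, symmetric])
  also have "\<dots> = gauss (p * r)"
    by (simp add: gauss_def \<psi>_frob power_mult T_power flip: power_inverse)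
  finally show ?thesis ..
qed

text \<open>The sum of \<open>T (inverse x)\<close> vanishes, so \<open>\<psi> x\<close> may be
  replaced by \<open>\<psi> x - 1\<close>, which is divisible by \<open>unif\<close>. The cofactor
  reduces to the sum of \<open>inverse x * tr x\<close>, whose value is -1.\<close>

lemma gauss_1:
  assumes "Q > 2"
  shows "\<exists>u. loc_unit u \<and> gauss 1 = unif * u"
proof -
  define u where "u = (\<Sum>x\<in>UNIV-{0}. T (inverse x) * (\<Sum>l<trn x. \<zeta> ^ l))"
  have nd: "\<not> Q - 1 dvd 1" using assms by auto
  have "gauss 1 = (\<Sum>x\<in>UNIV-{0}. (\<psi> x - 1) * T (inverse x)) + (\<Sum>x\<in>UNIV-{0}. T (inverse x))"
    by (simp add: gauss_def algebra_simps flip: sum.distrib)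
  also have "(\<Sum>x\<in>UNIV-{0}. T (inverse x)) = 0"
    using sum_nonzero_inverse[of T] sum_T_power[of 1] nd by simp
  also have "(\<Sum>x\<in>UNIV-{0}. (\<psi> x - 1) * T (inverse x)) = unif * u"
    unfolding u_def sum_distrib_left[of unif]
    by (intro sum.cong refl) (simp add: \<psi>_def power_diff_1_eq unif_def)
  finally have 1: "gauss 1 = unif * u" by simp
  have "\<rho> u = (\<Sum>x\<in>UNIV-{0}. inverse x * tr x)"
    unfolding u_def by (simp add: \<rho>_sum of_nat_trn)
  also have "\<dots> = (\<Sum>x\<in>UNIV-{0}. \<Sum>i<f. x ^ (p ^ i - 1))"
  proof (intro sum.cong refl)
    fix x :: 'a assume x: "x \<in> UNIV - {0}"
    have "inverse x * x ^ (p ^ i) = x ^ (p ^ i - 1)" for i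
    proof -
      have "p ^ i > 0" using p_pos by simp
      hence "x ^ (p ^ i) = x * x ^ (p ^ i - 1)" by (metis power_eq_if nat_neq_iff)
      thus ?thesis using x by simp
    qed
    thus "inverse x * tr x = (\<Sum>i<f. x ^ (p ^ i - 1))" by (simp add: tr_def sum_distrib_left)
  qed
  also have "\<dots> = (\<Sum>i<f. if Q - 1 dvd p ^ i - 1 then - 1 else 0)"
    by (subst sum.swap) (simp add: sum_power_field)
  \<comment> \<open>For \<open>0 < i < f\<close> the exponent \<open>p ^ i - 1\<close> lies strictly
    between 0 and \<open>Q - 1\<close>; only the exponent 0 remains.\<close>
  also have "\<dots> = (\<Sum>i<f. if i = 0 then - 1 else 0)"
  proof (intro sum.cong refl)
    fix i assume "i \<in> {..<f}"
    hence "p ^ i < Q" using p_gt_1 by (simp add: Q_eq)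
    moreover have "p ^ i > 1" if "i \<noteq> 0" using that p_gt_1 one_less_power by blast
    ultimately have "\<not> Q - 1 dvd p ^ i - 1" if "i \<noteq> 0"
      using that dvd_imp_le[of "Q - 1" "p ^ i - 1"] by fastforce
    thus "(if Q - 1 dvd p ^ i - 1 then - 1 else 0) = (if i = 0 then - 1 else 0 :: 'a)" by auto
  qed
  also have "\<dots> = - 1" using f_pos by simp
  finally have "\<rho> u \<noteq> 0" by simp
  moreover have "u \<in> \<O>" by (simp add: u_def)
  ultimately show ?thesis using 1 by (auto simp: loc_unit_def)
qed

end

section \<open>Stickelberger's theorem\<close>

context teichmueller
begin

text \<open>A last digit 0 is removed by \<open>gauss_mult_p\<close>. Otherwise \<open>r\<close> is
  lowered by 1, which costs one factor \<open>gauss 1\<close>, a unit times \<open>unif\<close>, and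
  lowers the digit sum by 1.\<close>

lemma gauss_dvd_unif_power:
  assumes "0 < r" "r < Q - 1"
  shows "gauss r \<preceq> unif ^ digit_sum p r"
  using assms
proof (induction r rule: less_induct)
  case (less r)
  show ?case
  proof (cases "p dvd r")
    case True
    then obtain r' where r': "r = p * r'" by (elim dvdE)
    hence r'_less: "r' < r" "0 < r'" using less.prems p_gt_1 by auto
    moreover have "r' < Q - 1" using r'_less(1) less.prems(2) by linarith
    ultimately have "gauss r' \<preceq> unif ^ digit_sum p r'" by (rule less.IH)
    thus ?thesis using digit_sum_mult[OF p_gt_1] by (simp add: r' gauss_mult_p)
  next
    case False
    obtain a where a: "r = Suc a" using less.prems by (cases r) auto
    have S: "digit_sum p r = Suc (digit_sum p a)"
      using digit_sum_Suc[OF p_gt_1] False a by simp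
    have "Q > 2" using less.prems by simp
    then obtain u where u: "loc_unit u" "gauss 1 = unif * u" using gauss_1 by blast
    have "unif = gauss 1 * inverse u" using u loc_unit_nonzero by simp
    hence g1: "gauss 1 \<preceq> unif" using loc_unit_inverse_mem[OF u(1)] unfolding loc_dvd_def by blast
    show ?thesis
    proof (cases "a = 0")
      case True
      thus ?thesis using g1 S a by simp
    next
      case a0: False
      have "\<not> Q - 1 dvd r" using less.prems by (auto dest: dvd_imp_le)
      hence "gauss r \<preceq> gauss a * gauss 1" using gauss_add_dvd[of a 1] a by simp
      also have "gauss a * gauss 1 \<preceq> unif ^ digit_sum p a * unif"
        using less.IH[of a] a a0 less.prems g1 by (intro loc_dvd_mult_mono) auto
      finally show ?thesis using S by (simp add: mult.commute)
    qed
  qed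
qed

text \<open>With \<open>s = Q - 1 - r\<close>, the product \<open>gauss r * gauss s\<close> is a
  unit times \<open>Q\<close> and contains as many factors \<open>unif\<close> as both digit sums
  together. At most \<open>digit_sum p s\<close> of them belong to \<open>gauss s\<close>.\<close>

lemma unif_power_dvd_gauss:
  assumes "0 < r" "r < Q - 1"
  shows "unif ^ digit_sum p r \<preceq> gauss r"
proof -
  define s where "s = Q - 1 - r"
  have s: "0 < s" "s < Q - 1" "Q - 1 - s = r" using assms by (auto simp: s_def)
  have S: "digit_sum p r + digit_sum p s = f * (p - 1)"
    using digit_sum_complement[OF p_gt_1, of r f] assms by (simp add: s_def Q_eq)
  obtain c where c: "c \<in> \<O>" "unif ^ digit_sum p s = gauss s * c"
    using gauss_dvd_unif_power[OF s(1,2)] unfolding loc_dvd_def by blast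
  obtain u where u: "loc_unit u" "of_nat Q = u * unif ^ (f * (p - 1))"
    using p_power_eq_unif_power[of f] by (auto simp: Q_eq)
  have split: "unif ^ (f * (p - 1)) = unif ^ digit_sum p r * unif ^ digit_sum p s"
    by (simp only: power_add flip: S)
  have "gauss r * unif ^ digit_sum p s = T (- 1) ^ s * of_nat Q * c"
    using gauss_complement[OF s(1,2)] unfolding s(3) c(2) by (simp only: mult.assoc[symmetric])
  also have "\<dots> = (unif ^ digit_sum p r * (T (- 1) ^ s * u * c)) * unif ^ digit_sum p s"
    using split by (simp add: u(2))
  finally have "gauss r = unif ^ digit_sum p r * (T (- 1) ^ s * u * c)"
    by (subst (asm) mult_cancel_right) simp
  moreover have "T (- 1) ^ s * u * c \<in> \<O>" using c u(1) by (simp add: loc_unit_def)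
  ultimately show ?thesis unfolding loc_dvd_def by blast
qed

text \<open>The dual basis of the functions \<open>\<lambda>x. T x ^ r\<close> with \<open>r < Q\<close>, where \<open>0 ^ 0 = 1\<close>: the
  exponents \<open>0\<close> and \<open>Q - 1\<close> differ only at the argument \<open>0\<close>.\<close>

definition dual :: "nat \<Rightarrow> 'a \<Rightarrow> complex" where
  "dual r x = (if r = 0 then of_bool (x = 0)
     else T (inverse x) ^ r / of_nat (Q - 1) - of_bool (r = Q - 1 \<and> x = 0))"

lemma loc_unit_Q_minus_1: "loc_unit (of_nat (Q - 1))"
  unfolding loc_unit_def using of_nat_Q_minus_1 by (simp only: of_nat_mem \<rho>_of_nat) simp

lemma of_bool_mem [simp]: "of_bool b \<in> \<O>"
  by (cases b) auto

lemma dual_mem [simp]: "dual r x \<in> \<O>"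
  using loc_unit_inverse_mem[OF loc_unit_Q_minus_1]
  by (simp add: dual_def divide_inverse del: of_nat_diff of_bool_conj)

lemma sum_dual_T_power:
  assumes "r < Q" "s < Q"
  shows "(\<Sum>x\<in>UNIV. dual r x * T x ^ s) = of_bool (r = s)"
proof (cases "r = 0")
  case True
  have "(\<Sum>x\<in>UNIV. dual r x * T x ^ s) = (\<Sum>x\<in>UNIV. if x = 0 then T x ^ s else 0)"
    using True by (intro sum.cong) (auto simp: dual_def)
  thus ?thesis using True by (simp add: power_0_left)
next
  case False
  define N where "N = Q - 1"
  have N: "N > 0" "r \<le> N" "s \<le> N" using assms Q_gt_1 by (auto simp: N_def)
  have "(\<Sum>x\<in>UNIV. dual r x * T x ^ s) =
      (\<Sum>x\<in>UNIV-{0}. dual r x * T x ^ s) + dual r 0 * 0 ^ s"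
    by (subst sum.remove[of _ 0]) (auto simp: add.commute)
  also have "dual r 0 * 0 ^ s = - of_bool (r = N \<and> s = 0)"
    using False by (simp add: dual_def power_0_left N_def)
  also have "(\<Sum>x\<in>UNIV-{0}. dual r x * T x ^ s) = (\<Sum>x\<in>UNIV-{0}. T x ^ (N - r + s) / of_nat N)"
  proof (intro sum.cong refl)
    fix x :: 'a assume x: "x \<in> UNIV - {0}"
    have "T x ^ N = 1" using x pow_Q_minus_1[of x] by (simp add: N_def flip: T_power)
    moreover have "T x ^ N = T x ^ r * T x ^ (N - r)" using N by (simp flip: power_add)
    ultimately have "inverse (T x ^ r) = T x ^ (N - r)" by (intro inverse_unique) simp
    hence "T (inverse x) ^ r = T x ^ (N - r)" by (simp only: T_inverse power_inverse)
    thus "dual r x * T x ^ s = T x ^ (N - r + s) / of_nat N"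
      using x False by (simp add: dual_def N_def power_add)
  qed
  also have "\<dots> = (if N dvd N - r + s then 1 else 0)"
    using sum_T_power[of "N - r + s"] N(1) by (simp add: N_def flip: sum_divide_distrib)
  \<comment> \<open>As \<open>0 < r\<close>, the exponent is below \<open>2 * N\<close>: it is
    \<open>N\<close> for \<open>r = s\<close> and 0 for \<open>r = N\<close>, \<open>s = 0\<close>.
    The latter case is cancelled by the correction term of \<open>dual\<close> at 0.\<close>
  also have "N dvd N - r + s \<longleftrightarrow> r = s \<or> (r = N \<and> s = 0)"
  proof
    assume "N dvd N - r + s"
    then obtain k where k: "N - r + s = N * k" by (elim dvdE)
    have "N * k < N * 2" using N False by (simp flip: k)
    hence "k < 2" by simp
    hence "k = 0 \<or> k = 1" by auto
    thus "r = s \<or> (r = N \<and> s = 0)" using k N by auto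
  qed (use N in auto)
  finally show ?thesis using False by auto
qed

text \<open>Completeness, the other half of the duality: it recovers a function on the field from
  its coefficients.\<close>

lemma sum_T_power_dual: "(\<Sum>r<Q. dual r y * T x ^ r) = of_bool (x = y)"
proof -
  define N where "N = Q - 1"
  have N: "N > 0" "Q = Suc N" using Q_gt_1 by (auto simp: N_def)
  have "(\<Sum>r<Q. dual r y * T x ^ r) = of_bool (y = 0) + (\<Sum>r<N. dual (Suc r) y * T x ^ Suc r)"
  proof -
    have "(\<Sum>r<Q. g r) = g 0 + (\<Sum>r<N. g (Suc r))" for g :: "nat \<Rightarrow> complex"
      unfolding N(2) by (rule sum.lessThan_Suc_shift)
    from this[of "\<lambda>r. dual r y * T x ^ r"] show ?thesis by (simp only: power_0) (simp add: dual_def[of 0])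
  qed
  also have "\<dots> = of_bool (x = y)"
  proof (cases "x = 0 \<or> y = 0")
    case True
    have y0: "(\<Sum>r<N. dual (Suc r) 0 * T x ^ Suc r) = (\<Sum>r<N. if r = N - 1 then - (T x ^ Suc r) else 0)"
      using N(1) by (intro sum.cong) (auto simp: dual_def N_def)
    have "T x ^ N = of_bool (x \<noteq> 0)"
      using pow_Q_minus_1[of x] N(1) by (auto simp: N_def power_0_left simp flip: T_power)
    hence "(\<Sum>r<N. dual (Suc r) 0 * T x ^ Suc r) = - of_bool (x \<noteq> 0)"
      unfolding y0 using N(1) by (simp del: power_Suc)
    thus ?thesis using True by (cases "y = 0") auto
  next
    case False
    define w where "w = T (x / y)"
    have w: "w ^ N = 1" using pow_Q_minus_1[of "x / y"] False by (simp add: w_def N_def flip: T_power)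
    have "w = T 1 \<longleftrightarrow> x / y = 1" unfolding w_def by (rule inj_eq[OF inj_T])
    hence w1: "w = 1 \<longleftrightarrow> x = y" using False by simp
    have "(\<Sum>r<N. dual (Suc r) y * T x ^ Suc r) = (\<Sum>r<N. w ^ Suc r / of_nat N)"
      using False by (intro sum.cong refl)
        (simp add: dual_def N_def w_def divide_inverse T_mult power_mult_distrib mult_ac)
    also have "\<dots> = w * (\<Sum>r<N. w ^ r) / of_nat N"
      by (simp add: sum_distrib_left sum_divide_distrib)
    also have "\<dots> = of_bool (x = y)"
      using w w1 N(1) by (cases "w = 1") (auto simp: geometric_sum)
    finally show ?thesis using False by simp
  qed
  finally show ?thesis .
qed

definition cf :: "nat \<Rightarrow> complex" where "cf r = (\<Sum>x\<in>UNIV. dual r x * \<psi> x)"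

lemma cf_mem [simp]: "cf r \<in> \<O>"
  by (simp add: cf_def)

lemma \<psi>_expansion: "\<psi> x = (\<Sum>r<Q. cf r * T x ^ r)"
proof -
  have "(\<Sum>r<Q. cf r * T x ^ r) = (\<Sum>y\<in>UNIV. (\<Sum>r<Q. dual r y * T x ^ r) * \<psi> y)"
    unfolding cf_def sum_distrib_right by (subst sum.swap) (simp only: mult_ac)
  also have "\<dots> = \<psi> x" by (simp add: sum_T_power_dual of_bool_def if_distrib[of "\<lambda>z. z * _"] cong: if_cong)
  finally show ?thesis ..
qed

lemma cf_0 [simp]: "cf 0 = 1"
proof -
  have "cf 0 = (\<Sum>x\<in>UNIV. if x = 0 then \<psi> x else 0)"
    unfolding cf_def by (intro sum.cong) (auto simp: dual_def)
  thus ?thesis by simp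
qed

text \<open>Away from 0 the dual function is the Gauss sum kernel over \<open>Q - 1\<close>; the
  argument 0 contributes only for \<open>r = Q - 1\<close>.\<close>

lemma cf_eq_gauss:
  assumes "0 < r"
  shows "of_nat (Q - 1) * cf r = gauss r - (if r = Q - 1 then of_nat (Q - 1) else 0)"
proof -
  define N where "N = Q - 1"
  have N: "N > 0" using Q_gt_1 by (simp add: N_def)
  have "cf r = (\<Sum>x\<in>UNIV-{0}. dual r x * \<psi> x) + dual r 0"
    unfolding cf_def by (subst sum.remove[of _ 0]) (auto simp: add.commute)
  also have "(\<Sum>x\<in>UNIV-{0}. dual r x * \<psi> x) = gauss r / of_nat N"
    unfolding gauss_def sum_divide_distrib
    using assms by (intro sum.cong) (auto simp: dual_def N_def)
  also have "dual r 0 = (if r = N then - 1 else 0)"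
    using assms by (auto simp: dual_def N_def)
  finally show ?thesis unfolding N_def[symmetric] using N by (simp add: field_simps)
qed

lemma cf_valuation:
  assumes "r < Q"
  shows "unif ^ digit_sum p r \<preceq> cf r \<and> cf r \<preceq> unif ^ digit_sum p r"
proof (cases "r = 0 \<or> r = Q - 1")
  case False
  hence r: "0 < r" "r < Q - 1" using assms by auto
  hence eq: "of_nat (Q - 1) * cf r = gauss r" using cf_eq_gauss[OF r(1)] by simp
  have "unif ^ digit_sum p r \<preceq> cf r"
    using unif_power_dvd_gauss[OF r] unfolding eq[symmetric]
    by (rule loc_dvd_cancel_unit[OF loc_unit_Q_minus_1])
  moreover have "cf r \<preceq> of_nat (Q - 1) * cf r" by (rule loc_dvd_mult_left) auto
  hence "cf r \<preceq> unif ^ digit_sum p r"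
    unfolding eq using gauss_dvd_unif_power[OF r] by (rule loc_dvd_trans)
  ultimately show ?thesis ..
next
  case True
  show ?thesis
  proof (cases "r = 0")
    case False
    hence r: "r = Q - 1" "0 < r" using True Q_gt_1 by auto
    have S: "digit_sum p r = f * (p - 1)"
      using digit_sum_complement[OF p_gt_1, of r f] r by (simp add: Q_eq)
    obtain u where u: "loc_unit u" "of_nat Q = u * unif ^ (f * (p - 1))"
      using p_power_eq_unif_power[of f] by (auto simp: Q_eq)
    \<comment> \<open>At the top exponent the Gauss sum is -1 and the correction is
      \<open>- (Q - 1)\<close>; together they give \<open>- Q\<close>, matching the maximal digit
      sum \<open>f * (p - 1)\<close>.\<close>
    have eq: "of_nat (Q - 1) * cf r = - (u * unif ^ digit_sum p r)"
    proof -
      have "of_nat (Q - 1) * cf r = - 1 - of_nat (Q - 1)"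
        using cf_eq_gauss[OF r(2)] gauss_multiple[of r] r(1) by simp
      also have "\<dots> = - of_nat Q" using Q_gt_1 by (simp add: of_nat_diff)
      finally show ?thesis by (simp only: u(2) S)
    qed
    have "unif ^ digit_sum p r \<preceq> of_nat (Q - 1) * cf r"
      unfolding eq using u(1) by (intro loc_dvd_uminus loc_dvd_mult_left) (auto simp: loc_unit_def)
    hence "unif ^ digit_sum p r \<preceq> cf r"
      by (rule loc_dvd_cancel_unit[OF loc_unit_Q_minus_1])
    moreover have "u * unif ^ digit_sum p r = - of_nat (Q - 1) * cf r" using eq by simp
    hence "cf r \<preceq> u * unif ^ digit_sum p r" by (simp only:) (intro loc_dvd_mult_left; simp del: of_nat_diff)
    hence "cf r \<preceq> unif ^ digit_sum p r" by (rule loc_dvd_cancel_unit[OF u(1)])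
    ultimately show ?thesis ..
  qed simp
qed

end

section \<open>Counting zeros of trace codewords\<close>

lemma sum_power_primitive_root:
  fixes z :: complex
  assumes "0 < n" "\<And>k. z ^ k = 1 \<longleftrightarrow> n dvd k"
  shows "(\<Sum>j<n. (z ^ M) ^ j) = (if n dvd M then of_nat n else 0)"
proof (cases "n dvd M")
  case False
  have "(z ^ M) ^ n = 1" using assms(2)[of "M * n"] by (simp add: power_mult)
  thus ?thesis using False assms(2)[of M] by (simp add: geometric_sum)
qed (use assms(2)[of M] in simp)

lemma primitive_root_of_unity_power_eq_1_iff:
  assumes "primitive_root_of_unity n x"
  shows "x ^ k = 1 \<longleftrightarrow> n dvd k"
proof
  assume "x ^ k = 1"
  have "x ^ k = x ^ (n * (k div n) + k mod n)" by simp
  also have "\<dots> = (x ^ n) ^ (k div n) * x ^ (k mod n)" by (simp only: power_add power_mult)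
  also have "\<dots> = x ^ (k mod n)" using assms by (simp add: primitive_root_of_unity_def)
  finally have "x ^ (k mod n) = 1" using \<open>x ^ k = 1\<close> by simp
  hence "\<not> 0 < k mod n" using assms by (auto simp: primitive_root_of_unity_def)
  thus "n dvd k" by auto
next
  assume "n dvd k"
  thus "x ^ k = 1" using assms by (auto simp: power_mult primitive_root_of_unity_def)
qed

lemma minus_1_dvd_power_minus_1: "(q - 1 :: nat) dvd q ^ m - 1"
proof (cases "q = 0")
  case True
  thus ?thesis by (cases m) auto
next
  case False
  then obtain k where "q = k + 1" by (metis Suc_eq_plus1 not0_implies_Suc)
  hence "[q = 1] (mod (q - 1))" by (simp only: cong_def add_diff_cancel_right' mod_add_self1)
  hence "[q ^ m = 1 ^ m] (mod (q - 1))" by (rule cong_pow)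
  thus ?thesis using cong_to_1_nat by simp
qed

locale teichmueller_subfield = teichmueller +
  fixes q e m :: nat
  assumes e_pos: "0 < e" and q_eq: "q = p ^ e" and f_eq: "f = e * m"
begin

text \<open>The subfield with \<open>q\<close> elements, realised as fixed points of the
  \<open>q\<close>-power map so that no second field type is involved.\<close>

definition Fq :: "'a set" where "Fq = {y. y ^ q = y}"

lemma q_gt_1: "q > 1"
  unfolding q_eq using p_gt_1 e_pos by (rule one_less_power)

lemma Q_eq_q: "Q = q ^ m"
  by (simp add: Q_eq q_eq f_eq power_mult)

lemma Fq_eq: "Fq = insert 0 {y. y ^ (q - 1) = 1}" and zero_notin: "0 \<notin> {y :: 'a. y ^ (q - 1) = 1}"
proof -
  have "y ^ q = y * y ^ (q - 1)" for y :: 'a using q_gt_1 by (cases q) auto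
  thus "Fq = insert 0 {y. y ^ (q - 1) = 1}" by (auto simp: Fq_def)
  show "0 \<notin> {y :: 'a. y ^ (q - 1) = 1}" using q_gt_1 by (simp add: power_0_left)
qed

text \<open>The element 0 contributes only for \<open>n = 0\<close>, where \<open>0 ^ 0 = 1\<close>;
  hence \<open>q\<close> there and \<open>q - 1\<close> for positive multiples of
  \<open>q - 1\<close>.\<close>

lemma sum_T_Fq:
  "(\<Sum>y\<in>Fq. T y ^ n) = (if n = 0 then of_nat q else if q - 1 dvd n then of_nat (q - 1) else 0)"
proof -
  have "q - 1 dvd Q - 1" unfolding Q_eq_q by (rule minus_1_dvd_power_minus_1)
  thus ?thesis
    using sum_T_power_roots_unity[of "q - 1" n] q_gt_1 zero_notin
    by (auto simp: Fq_eq power_0_left of_nat_diff)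
qed

lemma card_Fq: "card Fq = q"
proof -
  have "of_nat (card Fq) = (of_nat q :: complex)" using sum_T_Fq[of 0] by simp
  thus ?thesis by (simp only: of_nat_eq_iff)
qed

lemma Fq_power: "y \<in> Fq \<Longrightarrow> y ^ (q ^ i) = y"
  by (induction i) (auto simp: Fq_def power_mult)

lemma frob_q_add: "(x + y :: 'a) ^ q = x ^ q + y ^ q"
  unfolding q_eq by (rule frob_add_iter)

lemma trace_Fq_mult: "y \<in> Fq \<Longrightarrow> trace q m (y * c) = y * trace q m c"
  by (simp add: trace_def power_mult_distrib Fq_power sum_distrib_left)

text \<open>Transitivity of the trace, obtained by writing the Frobenius exponents as
  \<open>a * e + i\<close> with \<open>i < e\<close>.\<close>

lemma tr_eq_trace: "tr z = (\<Sum>i<e. trace q m z ^ (p ^ i))"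
proof -
  have "tr z = (\<Sum>n<m * e. z ^ (p ^ n))"
    unfolding tr_def by (simp only: f_eq mult.commute[of e])
  also have "\<dots> = (\<Sum>a<m. \<Sum>n\<in>{a * e..<a * e + e}. z ^ (p ^ n))"
    by (rule sum.nat_group[symmetric])
  also have "\<dots> = (\<Sum>a<m. \<Sum>i<e. z ^ (p ^ (a * e + i)))"
  proof (rule sum.cong[OF refl])
    fix a
    show "(\<Sum>n\<in>{a * e..<a * e + e}. z ^ (p ^ n)) = (\<Sum>i<e. z ^ (p ^ (a * e + i)))"
      by (rule sum.reindex_bij_witness[of _ "\<lambda>i. a * e + i" "\<lambda>n. n - a * e"]) auto
  qed
  also have "\<dots> = (\<Sum>i<e. \<Sum>a<m. (z ^ (q ^ a)) ^ (p ^ i))"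
    by (subst sum.swap) (simp add: q_eq power_add mult.commute flip: power_mult)
  also have "\<dots> = (\<Sum>i<e. trace q m z ^ (p ^ i))"
    unfolding trace_def
    by (intro sum.cong refl freshmans_dream_sum'[symmetric]) (use CHAR_eq prime_p in auto)
  finally show ?thesis .
qed

text \<open>For \<open>y\<close> in \<open>Fq\<close>, whether \<open>\<psi> (y * c)\<close> is 1
  depends only on \<open>y * trace q m c\<close>. The character is trivial on \<open>Fq\<close>
  exactly when this trace vanishes, so the sum detects zero coordinates.\<close>

lemma sum_\<psi>_Fq: "(\<Sum>y\<in>Fq. \<psi> (y * c)) = (if trace q m c = 0 then of_nat q else 0)"
proof (cases "trace q m c = 0")
  case True
  have "\<psi> (y * c) = 1" if "y \<in> Fq" for y
    unfolding \<psi>_eq_1_iff tr_eq_trace trace_Fq_mult[OF that] True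
    using p_pos by (simp add: power_0_left)
  thus ?thesis using True card_Fq by simp
next
  case False
  define t where "t = trace q m c"
  \<comment> \<open>The multiples of a nonzero \<open>t\<close> are \<open>q\<close> distinct
    elements, more than the \<open>p ^ (e - 1)\<close> zeros the trace polynomial can have.\<close>
  have "card ((\<lambda>y. y * t) ` Fq) = q"
    using False card_Fq by (subst card_image) (auto simp: inj_on_def t_def)
  moreover have "p ^ (e - 1) < q" unfolding q_eq
    using p_gt_1 e_pos by (intro power_strict_increasing) auto
  ultimately obtain y where y: "y \<in> Fq" "(\<Sum>i<e. (y * t) ^ (p ^ i)) \<noteq> 0"
    using trace_polynomial_nonzero[OF p_gt_1 e_pos, of "(\<lambda>y. y * t) ` Fq"] by auto
  have "\<psi> (y * c) \<noteq> 1"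
    using y by (simp add: \<psi>_eq_1_iff tr_eq_trace trace_Fq_mult t_def)
  moreover have "(- x) ^ q = - (x ^ q)" for x :: 'a
    using frob_q_add[of x "- x"] q_gt_1 by (simp add: power_0_left eq_neg_iff_add_eq_0 add.commute)
  ultimately have "(\<Sum>y\<in>Fq. \<psi> (y * c)) = 0"
    using y(1) by (intro sum_\<psi>_subgroup[of Fq y]) (auto simp: Fq_def frob_q_add)
  thus ?thesis using False by simp
qed

lemma sum_\<psi>_eq_hamming_weight:
  assumes "finite A"
  shows "(\<Sum>j\<in>A. \<Sum>y\<in>Fq. \<psi> (y * c j)) =
    of_nat (q * card A) - of_nat (q * hamming_weight A (\<lambda>j. trace q m (c j)))"
proof -
  let ?Z = "{j \<in> A. trace q m (c j) = 0}" and ?W = "{j \<in> A. trace q m (c j) \<noteq> 0}"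
  have "card A = card (?Z \<union> ?W)" by (intro arg_cong[of _ _ card]) auto
  also have "\<dots> = card ?Z + card ?W" using assms by (intro card_Un_disjoint) auto
  finally have card: "card A = card ?Z + card ?W" .
  have "(\<Sum>j\<in>A. \<Sum>y\<in>Fq. \<psi> (y * c j)) = (\<Sum>j\<in>A. if trace q m (c j) = 0 then of_nat q else 0)"
    by (simp add: sum_\<psi>_Fq)
  also have "\<dots> = of_nat (card ?Z) * of_nat q"
    using assms by (simp add: sum.If_cases Int_def)
  finally show ?thesis by (simp add: hamming_weight_def card algebra_simps)
qed

lemma \<psi>_sum_expansion:
  assumes "finite I"
  shows "\<psi> (\<Sum>i\<in>I. x i) = (\<Sum>r\<in>I \<rightarrow>\<^sub>E {..<Q}. \<Prod>i\<in>I. cf (r i) * T (x i) ^ r i)"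
  by (simp only: \<psi>_sum \<psi>_expansion[of "x _"] prod_sum_PiE[OF assms finite_lessThan])

text \<open>Multiplicativity of \<open>T\<close> separates \<open>\<alpha>\<close>, \<open>y\<close>
  and \<open>j\<close>, so the sums over \<open>y\<close> and over \<open>j\<close> can be evaluated
  independently.\<close>

lemma sum_\<psi>_expansion:
  assumes "finite I"
  shows "(\<Sum>j\<in>A. \<Sum>y\<in>Fq. \<psi> (y * (\<Sum>i\<in>I. \<alpha> i * g i j))) =
    (\<Sum>r\<in>I \<rightarrow>\<^sub>E {..<Q}. (\<Prod>i\<in>I. cf (r i)) * (\<Prod>i\<in>I. T (\<alpha> i) ^ r i) *
       (\<Sum>y\<in>Fq. T y ^ (\<Sum>i\<in>I. r i)) * (\<Sum>j\<in>A. \<Prod>i\<in>I. T (g i j) ^ r i))"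
proof -
  have "\<psi> (y * (\<Sum>i\<in>I. \<alpha> i * g i j)) = (\<Sum>r\<in>I \<rightarrow>\<^sub>E {..<Q}.
      (\<Prod>i\<in>I. cf (r i)) * (\<Prod>i\<in>I. T (\<alpha> i) ^ r i) * (T y ^ (\<Sum>i\<in>I. r i) * (\<Prod>i\<in>I. T (g i j) ^ r i)))"
    for y j
    unfolding sum_distrib_left \<psi>_sum_expansion[OF assms]
    by (intro sum.cong refl)
      (simp add: T_mult power_mult_distrib prod.distrib power_sum mult_ac)
  hence "(\<Sum>j\<in>A. \<Sum>y\<in>Fq. \<psi> (y * (\<Sum>i\<in>I. \<alpha> i * g i j))) =
    (\<Sum>j\<in>A. \<Sum>y\<in>Fq. \<Sum>r\<in>I \<rightarrow>\<^sub>E {..<Q}. (\<Prod>i\<in>I. cf (r i)) * (\<Prod>i\<in>I. T (\<alpha> i) ^ r i) *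
      (T y ^ (\<Sum>i\<in>I. r i) * (\<Prod>i\<in>I. T (g i j) ^ r i)))"
    by simp
  also have "\<dots> = (\<Sum>j\<in>A. \<Sum>r\<in>I \<rightarrow>\<^sub>E {..<Q}. \<Sum>y\<in>Fq. (\<Prod>i\<in>I. cf (r i)) *
      (\<Prod>i\<in>I. T (\<alpha> i) ^ r i) * (T y ^ (\<Sum>i\<in>I. r i) * (\<Prod>i\<in>I. T (g i j) ^ r i)))"
    by (rule sum.cong[OF refl], rule sum.swap)
  also have "\<dots> = (\<Sum>r\<in>I \<rightarrow>\<^sub>E {..<Q}. \<Sum>j\<in>A. \<Sum>y\<in>Fq. (\<Prod>i\<in>I. cf (r i)) *
      (\<Prod>i\<in>I. T (\<alpha> i) ^ r i) * (T y ^ (\<Sum>i\<in>I. r i) * (\<Prod>i\<in>I. T (g i j) ^ r i)))"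
    by (rule sum.swap)
  also have "\<dots> = (\<Sum>r\<in>I \<rightarrow>\<^sub>E {..<Q}. (\<Prod>i\<in>I. cf (r i)) * (\<Prod>i\<in>I. T (\<alpha> i) ^ r i) *
       (\<Sum>y\<in>Fq. T y ^ (\<Sum>i\<in>I. r i)) * (\<Sum>j\<in>A. \<Prod>i\<in>I. T (g i j) ^ r i))"
    by (intro sum.cong refl, subst sum.swap)
      (simp add: sum_distrib_left sum_distrib_right mult_ac)
  finally show ?thesis .
qed

text \<open>The sum over the product set factors into one geometric sum for each cyclic
  component.\<close>

lemma sum_T_prod_over_group:
  fixes n :: "nat \<Rightarrow> nat" and \<gamma> :: "nat \<Rightarrow> 'a" and s :: "nat \<Rightarrow> nat \<Rightarrow> nat" and h k :: nat
  assumes "\<And>l. l < h \<Longrightarrow> primitive_root_of_unity (n l) (\<gamma> l)"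
  shows "(\<Sum>j\<in>(\<Pi>\<^sub>E l\<in>{..<h}. {..<n l}). \<Prod>i<k. T (\<Prod>l<h. \<gamma> l ^ (s i l * j l)) ^ r i) =
    (if \<forall>l<h. n l dvd (\<Sum>i<k. r i * s i l) then of_nat (\<Prod>l<h. n l) else 0)"
proof -
  have "(\<Prod>i<k. T (\<Prod>l<h. \<gamma> l ^ (s i l * j l)) ^ r i) =
      (\<Prod>l<h. (T (\<gamma> l) ^ (\<Sum>i<k. r i * s i l)) ^ j l)" for j
  proof -
    have "(\<Prod>i<k. T (\<Prod>l<h. \<gamma> l ^ (s i l * j l)) ^ r i) =
        (\<Prod>i<k. \<Prod>l<h. T (\<gamma> l) ^ (r i * s i l * j l))"
      by (intro prod.cong refl)
        (simp add: T_prod T_power prod_power_distrib mult_ac flip: power_mult)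
    also have "\<dots> = (\<Prod>l<h. \<Prod>i<k. T (\<gamma> l) ^ (r i * s i l * j l))" by (rule prod.swap)
    also have "\<dots> = (\<Prod>l<h. (T (\<gamma> l) ^ (\<Sum>i<k. r i * s i l)) ^ j l)"
      by (simp add: power_sum prod_power_distrib flip: power_mult)
    finally show ?thesis .
  qed
  hence "(\<Sum>j\<in>(\<Pi>\<^sub>E l\<in>{..<h}. {..<n l}). \<Prod>i<k. T (\<Prod>l<h. \<gamma> l ^ (s i l * j l)) ^ r i) =
      (\<Prod>l<h. \<Sum>j<n l. (T (\<gamma> l) ^ (\<Sum>i<k. r i * s i l)) ^ j)"
    by (subst prod_sum_PiE) simp_all
  also have "\<dots> = (\<Prod>l<h. if n l dvd (\<Sum>i<k. r i * s i l) then of_nat (n l) else 0)"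
  proof (intro prod.cong refl sum_power_primitive_root)
    fix l a assume l: "l \<in> {..<h}"
    thus "n l > 0" using assms by (auto simp: primitive_root_of_unity_def)
    have "T (\<gamma> l) ^ a = 1 \<longleftrightarrow> \<gamma> l ^ a = 1"
      using inj_eq[OF inj_T, of "\<gamma> l ^ a" 1] by (simp add: T_power)
    thus "T (\<gamma> l) ^ a = 1 \<longleftrightarrow> n l dvd a"
      using primitive_root_of_unity_power_eq_1_iff[OF assms] l by simp
  qed
  also have "\<dots> = (if \<forall>l<h. n l dvd (\<Sum>i<k. r i * s i l) then of_nat (\<Prod>l<h. n l) else 0)"
    by (auto intro!: prod_zero)
  finally show ?thesis .
qed

end

section \<open>The weight formula and its valuation\<close>

lemma hamming_weight_restrict: "hamming_weight A (restrict c A) = hamming_weight A c"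
  unfolding hamming_weight_def by (rule arg_cong[of _ _ card]) auto

locale trace_code = teichmueller_subfield _ _ _ _ \<rho> for \<rho> :: "complex \<Rightarrow> 'a::{field,finite}" +
  fixes h k :: nat and n :: "nat \<Rightarrow> nat" and \<gamma> :: "nat \<Rightarrow> 'a" and s :: "nat \<Rightarrow> nat \<Rightarrow> nat"
  assumes prim: "\<And>l. l < h \<Longrightarrow> primitive_root_of_unity (n l) (\<gamma> l)"
begin

definition group_set :: "(nat \<Rightarrow> nat) set" where
  "group_set = (\<Pi>\<^sub>E l\<in>{..<h}. {..<n l})"

definition weight :: "(nat \<Rightarrow> 'a) \<Rightarrow> nat" where
  "weight \<alpha> = hamming_weight group_set
     (\<lambda>j. trace q m (\<Sum>i<k. \<alpha> i * (\<Prod>l<h. \<gamma> l ^ (s i l * j l))))"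

text \<open>Extensional functions make this set finite and identify vectors that agree below
  \<open>k\<close>.\<close>

definition exponents :: "(nat \<Rightarrow> nat) set" where
  "exponents = {r \<in> {..<k} \<rightarrow>\<^sub>E {..<Q}. 0 < (\<Sum>i<k. r i) \<and> q - 1 dvd (\<Sum>i<k. r i) \<and>
     (\<forall>l<h. n l dvd (\<Sum>i<k. r i * s i l))}"

lemma finite_exponents: "finite exponents"
  unfolding exponents_def by (simp add: finite_PiE)

lemma n_dvd_Q_minus_1: "l < h \<Longrightarrow> n l dvd Q - 1"
proof -
  assume l: "l < h"
  have "\<gamma> l \<noteq> 0"
    using prim[OF l] by (auto simp: primitive_root_of_unity_def power_0_left)
  thus ?thesis
    using pow_Q_minus_1 primitive_root_of_unity_power_eq_1_iff[OF prim[OF l]] by blast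
qed

lemma not_p_dvd_prod_n: "\<not> p dvd (\<Prod>l<h. n l)"
proof
  assume "p dvd (\<Prod>l<h. n l)"
  then obtain l where "l < h" "p dvd n l" using prime_p by (auto simp: prime_dvd_prod_iff)
  hence "p dvd Q - 1" using n_dvd_Q_minus_1 dvd_trans by blast
  moreover have "p dvd Q" using f_pos by (simp add: Q_eq dvd_power)
  ultimately have "p dvd Q - (Q - 1)" by (blast intro: dvd_diff_nat)
  thus False using Q_gt_1 p_gt_1 by simp
qed

text \<open>Each \<open>n l\<close> divides \<open>Q - 1\<close>, so \<open>p\<close> divides
  neither \<open>q - 1\<close> nor the group order.\<close>

lemma loc_unit_scale: "loc_unit (of_nat ((q - 1) * (\<Prod>l<h. n l)))"
proof -
  have "\<not> p dvd q - 1"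
  proof
    assume "p dvd q - 1"
    moreover have "p dvd q" using e_pos by (simp add: q_eq dvd_power)
    ultimately have "p dvd q - (q - 1)" by (blast intro: dvd_diff_nat)
    thus False using q_gt_1 p_gt_1 by simp
  qed
  hence "\<not> p dvd (q - 1) * (\<Prod>l<h. n l)"
    using not_p_dvd_prod_n prime_p by (simp add: prime_dvd_mult_iff)
  thus ?thesis unfolding loc_unit_def \<rho>_of_nat of_nat_eq_0_iff by simp
qed

lemma weight_expansion:
  "of_nat (q * weight \<alpha>) = - of_nat ((q - 1) * (\<Prod>l<h. n l)) *
    (\<Sum>r\<in>exponents. (\<Prod>i<k. cf (r i)) * (\<Prod>i<k. T (\<alpha> i) ^ r i))"
proof -
  let ?A = group_set
  define P where "P = {..<k} \<rightarrow>\<^sub>E {..<Q}"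
  define Y where "Y r = (\<Sum>y\<in>Fq. T y ^ (\<Sum>i<k. r i))" for r :: "nat \<Rightarrow> nat"
  define X where "X r = (\<Sum>j\<in>?A. \<Prod>i<k. T (\<Prod>l<h. \<gamma> l ^ (s i l * j l)) ^ r i)" for r
  define B where "B r = (\<Prod>i<k. cf (r i)) * (\<Prod>i<k. T (\<alpha> i) ^ r i)" for r
  \<comment> \<open>The zero exponent vector. Its term is \<open>q * card ?A\<close>, which cancels
    against the same term in the count of zeros.\<close>
  define Z :: "nat \<Rightarrow> nat" where "Z = (\<lambda>i\<in>{..<k}. 0)"
  have finA: "finite ?A" unfolding group_set_def by (simp add: finite_PiE)
  have cardA: "card ?A = (\<Prod>l<h. n l)" unfolding group_set_def by (simp add: card_PiE)
  have finP: "finite P" by (simp add: P_def finite_PiE)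
  have ZP: "Z \<in> P" using Q_gt_1 by (auto simp: Z_def P_def)
  have Z0: "(\<Sum>i<k. Z i) = 0" "\<And>i. i < k \<Longrightarrow> Z i = 0" by (simp_all add: Z_def)
  have X: "X r = (if \<forall>l<h. n l dvd (\<Sum>i<k. r i * s i l) then of_nat (\<Prod>l<h. n l) else 0)" for r
    unfolding X_def group_set_def by (rule sum_T_prod_over_group[OF prim])
  have Y: "Y r = (if (\<Sum>i<k. r i) = 0 then of_nat q
      else if q - 1 dvd (\<Sum>i<k. r i) then of_nat (q - 1) else 0)" for r
    unfolding Y_def by (rule sum_T_Fq)
  have pos: "(\<Sum>i<k. r i) \<noteq> 0" if "r \<in> P - {Z}" for r
  proof
    assume "(\<Sum>i<k. r i) = 0"
    hence "r = Z"
      using that ZP Z0 unfolding P_def by (intro PiE_ext[of r "{..<k}" "\<lambda>_. {..<Q}"]) auto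
    thus False using that by simp
  qed
  have "of_nat (q * card ?A) - of_nat (q * weight \<alpha>) = (\<Sum>r\<in>P. B r * Y r * X r)"
    unfolding weight_def sum_\<psi>_eq_hamming_weight[OF finA, symmetric] B_def Y_def X_def P_def
    by (rule sum_\<psi>_expansion) simp
  also have "\<dots> = B Z * Y Z * X Z + (\<Sum>r\<in>P - {Z}. B r * Y r * X r)"
    using finP ZP by (rule sum.remove)
  also have "B Z * Y Z * X Z = of_nat (q * card ?A)"
  proof -
    have "X Z = of_nat (\<Prod>l<h. n l)" unfolding X by (rule if_P) (simp add: Z_def)
    moreover have "Y Z = of_nat q" unfolding Y using Z0(1) by (rule if_P)
    moreover have "B Z = 1" by (simp add: B_def Z0)
    ultimately show ?thesis by (simp only: cardA of_nat_mult mult_1)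
  qed
  \<comment> \<open>A nonzero vector outside \<open>exponents\<close> violates a congruence, so its
    character sum over \<open>Fq\<close> or over the group vanishes.\<close>
  also have "(\<Sum>r\<in>P - {Z}. B r * Y r * X r) = (\<Sum>r\<in>exponents. B r * Y r * X r)"
  proof (rule sum.mono_neutral_right)
    show "exponents \<subseteq> P - {Z}"
    proof
      fix r assume r: "r \<in> exponents"
      hence "(\<Sum>i<k. r i) \<noteq> 0" unfolding exponents_def by blast
      hence "r \<noteq> Z" using Z0(1) by metis
      thus "r \<in> P - {Z}" using r unfolding exponents_def P_def by blast
    qed
    show "\<forall>r\<in>P - {Z} - exponents. B r * Y r * X r = 0"
    proof
      fix r assume r: "r \<in> P - {Z} - exponents"
      hence nz: "(\<Sum>i<k. r i) \<noteq> 0" using pos by blast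
      hence "0 < (\<Sum>i<k. r i)" by (rule neq0_conv[THEN iffD1])
      hence "\<not> q - 1 dvd (\<Sum>i<k. r i) \<or> \<not> (\<forall>l<h. n l dvd (\<Sum>i<k. r i * s i l))"
        using r unfolding exponents_def P_def by blast
      thus "B r * Y r * X r = 0"
      proof
        assume "\<not> q - 1 dvd (\<Sum>i<k. r i)"
        hence "Y r = 0" unfolding Y using nz by (simp only: if_False)
        thus ?thesis by simp
      next
        assume "\<not> (\<forall>l<h. n l dvd (\<Sum>i<k. r i * s i l))"
        hence "X r = 0" unfolding X by (rule if_not_P)
        thus ?thesis by simp
      qed
    qed
  qed (use finP in simp)
  also have "\<dots> = (\<Sum>r\<in>exponents. of_nat ((q - 1) * (\<Prod>l<h. n l)) * B r)"
  proof (rule sum.cong[OF refl])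
    fix r assume "r \<in> exponents"
    hence r: "(\<Sum>i<k. r i) \<noteq> 0" "q - 1 dvd (\<Sum>i<k. r i)"
      "\<forall>l<h. n l dvd (\<Sum>i<k. r i * s i l)" unfolding exponents_def by blast+
    have "X r = of_nat (\<Prod>l<h. n l)" unfolding X using r(3) by (rule if_P)
    moreover have "Y r = of_nat (q - 1)" unfolding Y using r(1,2) by (simp only: if_True if_False)
    ultimately show "B r * Y r * X r = of_nat ((q - 1) * (\<Prod>l<h. n l)) * B r"
      by (simp only: of_nat_mult mult_ac)
  qed
  also have "\<dots> = of_nat ((q - 1) * (\<Prod>l<h. n l)) * (\<Sum>r\<in>exponents. B r)"
    by (rule sum_distrib_left[symmetric])
  finally have "- of_nat (q * weight \<alpha>) = of_nat ((q - 1) * (\<Prod>l<h. n l)) * (\<Sum>r\<in>exponents. B r)"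
    by (simp only: diff_conv_add_uminus add_left_cancel)
  from arg_cong[OF this, of uminus] show ?thesis
    unfolding B_def by (simp only: minus_minus mult_minus_left)
qed

lemma prod_cf_valuation:
  assumes "r \<in> exponents"
  shows "unif ^ (\<Sum>i<k. digit_sum p (r i)) \<preceq> (\<Prod>i<k. cf (r i))"
    and "(\<Prod>i<k. cf (r i)) \<preceq> unif ^ (\<Sum>i<k. digit_sum p (r i))"
proof -
  have "r i < Q" if "i < k" for i using assms that unfolding exponents_def by auto
  thus "unif ^ (\<Sum>i<k. digit_sum p (r i)) \<preceq> (\<Prod>i<k. cf (r i))"
    and "(\<Prod>i<k. cf (r i)) \<preceq> unif ^ (\<Sum>i<k. digit_sum p (r i))"
    unfolding power_sum using cf_valuation by (auto intro!: loc_dvd_prod)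
qed

lemma unif_power_dvd_mono: "a \<le> b \<Longrightarrow> unif ^ a \<preceq> unif ^ b"
  unfolding loc_dvd_def by (intro bexI[of _ "unif ^ (b - a)"]) (auto simp flip: power_add)

lemma loc_dvd_p_power_iff: "of_nat (p ^ t) \<preceq> a \<longleftrightarrow> unif ^ (t * (p - 1)) \<preceq> a"
proof -
  obtain u where u: "loc_unit u" "of_nat (p ^ t) = u * unif ^ (t * (p - 1))"
    using p_power_eq_unif_power by blast
  have "unif ^ (t * (p - 1)) \<preceq> of_nat (p ^ t)"
    unfolding u(2) using u(1) by (intro loc_dvd_mult_left) (auto simp: loc_unit_def)
  moreover have "of_nat (p ^ t) \<preceq> u * unif ^ (t * (p - 1))" by (simp only: u(2) loc_dvd_refl)
  hence "of_nat (p ^ t) \<preceq> unif ^ (t * (p - 1))" by (rule loc_dvd_cancel_unit[OF u(1)])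
  ultimately show ?thesis using loc_dvd_trans by blast
qed

lemma power_dvd_weight:
  assumes "\<And>r. r \<in> exponents \<Longrightarrow> M * (p - 1) \<le> (\<Sum>i<k. digit_sum p (r i))"
  shows "p ^ M dvd q * weight \<alpha>"
proof (rule loc_dvd_nat_imp_dvd)
  have "unif ^ (M * (p - 1)) \<preceq> (\<Prod>i<k. cf (r i)) * (\<Prod>i<k. T (\<alpha> i) ^ r i)"
    if "r \<in> exponents" for r
  proof -
    have "unif ^ (M * (p - 1)) \<preceq> unif ^ (\<Sum>i<k. digit_sum p (r i))"
      by (rule unif_power_dvd_mono[OF assms[OF that]])
    also have "\<dots> \<preceq> (\<Prod>i<k. cf (r i))" by (rule prod_cf_valuation[OF that])
    finally show ?thesis by (rule loc_dvd_mult_right) simp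
  qed
  hence "unif ^ (M * (p - 1)) \<preceq> of_nat (q * weight \<alpha>)"
    unfolding weight_expansion by (intro loc_dvd_mult_left[OF loc_dvd_sum] uminus_mem of_nat_mem)
  thus "of_nat (p ^ M) \<preceq> of_nat (q * weight \<alpha>)" by (simp only: loc_dvd_p_power_iff)
qed

text \<open>Pairing the expansion of the weight with the dual basis isolates one coefficient.\<close>

lemma weight_dual:
  assumes "r \<in> exponents"
  shows "(\<Sum>\<alpha>\<in>{..<k} \<rightarrow>\<^sub>E UNIV. (\<Prod>i<k. dual (r i) (\<alpha> i)) * of_nat (q * weight \<alpha>)) =
    - of_nat ((q - 1) * (\<Prod>l<h. n l)) * (\<Prod>i<k. cf (r i))"
proof -
  let ?V = "{..<k} \<rightarrow>\<^sub>E (UNIV :: 'a set)" and ?c = "- of_nat ((q - 1) * (\<Prod>l<h. n l)) :: complex"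
  \<comment> \<open>Orthogonality in several variables: the sum over \<open>\<alpha>\<close> factors
    into the one-variable relations.\<close>
  have orth: "(\<Sum>\<alpha>\<in>?V. (\<Prod>i<k. dual (r i) (\<alpha> i)) * (\<Prod>i<k. T (\<alpha> i) ^ r' i)) = of_bool (r = r')"
    if r': "r' \<in> exponents" for r'
  proof -
    have lt: "r i < Q" "r' i < Q" if "i < k" for i
      using assms r' that unfolding exponents_def by auto
    have "(\<Sum>\<alpha>\<in>?V. (\<Prod>i<k. dual (r i) (\<alpha> i)) * (\<Prod>i<k. T (\<alpha> i) ^ r' i)) =
        (\<Prod>i<k. \<Sum>x\<in>UNIV. dual (r i) x * T x ^ r' i)"
      by (subst prod_sum_PiE) (simp_all add: prod.distrib)
    also have "\<dots> = (\<Prod>i<k. of_bool (r i = r' i))"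
      using lt by (intro prod.cong refl sum_dual_T_power) auto
    also have "\<dots> = of_bool (r = r')"
    proof (cases "r = r'")
      case False
      have "\<exists>i<k. r i \<noteq> r' i"
      proof (rule ccontr)
        assume "\<not> ?thesis"
        hence "r = r'"
          using assms r' unfolding exponents_def
          by (intro PiE_ext[of r "{..<k}" "\<lambda>_. {..<Q}" r']) auto
        with False show False by contradiction
      qed
      thus ?thesis using False by (simp add: Bex_def)
    qed simp
    finally show ?thesis .
  qed
  define E where "E \<alpha> = (\<Prod>i<k. dual (r i) (\<alpha> i))" for \<alpha>
  define B where "B r' = (\<Prod>i<k. cf (r' i))" for r' :: "nat \<Rightarrow> nat"
  define V where "V r' \<alpha> = (\<Prod>i<k. T (\<alpha> i) ^ r' i)" for r' :: "nat \<Rightarrow> nat" and \<alpha>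
  have orth': "(\<Sum>\<alpha>\<in>?V. E \<alpha> * V r' \<alpha>) = of_bool (r = r')" if "r' \<in> exponents" for r'
    unfolding E_def V_def by (rule orth[OF that])
  have "(\<Sum>\<alpha>\<in>?V. E \<alpha> * of_nat (q * weight \<alpha>)) =
      (\<Sum>\<alpha>\<in>?V. \<Sum>r'\<in>exponents. ?c * B r' * (E \<alpha> * V r' \<alpha>))"
  proof (rule sum.cong[OF refl])
    fix \<alpha>
    have "of_nat (q * weight \<alpha>) = ?c * (\<Sum>r'\<in>exponents. B r' * V r' \<alpha>)"
      unfolding B_def V_def by (rule weight_expansion)
    thus "E \<alpha> * of_nat (q * weight \<alpha>) = (\<Sum>r'\<in>exponents. ?c * B r' * (E \<alpha> * V r' \<alpha>))"
      by (simp only: sum_distrib_left mult_ac)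
  qed
  also have "\<dots> = (\<Sum>r'\<in>exponents. \<Sum>\<alpha>\<in>?V. ?c * B r' * (E \<alpha> * V r' \<alpha>))"
    by (rule sum.swap)
  also have "\<dots> = (\<Sum>r'\<in>exponents. ?c * B r' * of_bool (r = r'))"
  proof (rule sum.cong[OF refl])
    fix r' assume r': "r' \<in> exponents"
    show "(\<Sum>\<alpha>\<in>?V. ?c * B r' * (E \<alpha> * V r' \<alpha>)) = ?c * B r' * of_bool (r = r')"
      unfolding orth'[OF r', symmetric] by (rule sum_distrib_left[symmetric])
  qed
  also have "\<dots> = (\<Sum>r'\<in>exponents. if r' = r then ?c * B r' else 0)"
    by (intro sum.cong refl) auto
  also have "\<dots> = ?c * B r"
    using assms finite_exponents by simp
  finally show ?thesis by (simp only: E_def B_def)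
qed

text \<open>If all scaled weights were divisible by \<open>p ^ Suc M\<close>, pairing with
  \<open>dual\<close>, whose values lie in \<open>\<O>\<close>, would force this on the coefficient
  at \<open>r\<close>, whose valuation is only \<open>M * (p - 1)\<close>.\<close>

lemma exists_weight_not_dvd:
  assumes "r \<in> exponents" "(\<Sum>i<k. digit_sum p (r i)) = M * (p - 1)"
  shows "\<exists>\<alpha>. \<not> p ^ Suc M dvd q * weight \<alpha>"
proof (rule ccontr)
  assume "\<not> ?thesis"
  hence "p ^ Suc M dvd q * weight \<alpha>" for \<alpha> by blast
  hence "of_nat (p ^ Suc M) \<preceq> of_nat (q * weight \<alpha>)" for \<alpha>
    unfolding loc_dvd_def by (metis dvdE of_nat_mult of_nat_mem)
  hence "of_nat (p ^ Suc M) \<preceq>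
      (\<Sum>\<alpha>\<in>{..<k} \<rightarrow>\<^sub>E UNIV. (\<Prod>i<k. dual (r i) (\<alpha> i)) * of_nat (q * weight \<alpha>))"
    by (intro loc_dvd_sum loc_dvd_mult_left) simp_all
  hence "of_nat (p ^ Suc M) \<preceq> - (of_nat ((q - 1) * (\<Prod>l<h. n l)) * (\<Prod>i<k. cf (r i)))"
    unfolding weight_dual[OF assms(1)] by (simp only: mult_minus_left)
  hence "of_nat (p ^ Suc M) \<preceq> of_nat ((q - 1) * (\<Prod>l<h. n l)) * (\<Prod>i<k. cf (r i))"
    using loc_dvd_uminus by fastforce
  hence "of_nat (p ^ Suc M) \<preceq> (\<Prod>i<k. cf (r i))"
    by (rule loc_dvd_cancel_unit[OF loc_unit_scale])
  also have "\<dots> \<preceq> unif ^ (M * (p - 1))"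
    using prod_cf_valuation(2)[OF assms(1)] assms(2) by simp
  finally have "unif ^ (Suc M * (p - 1)) \<preceq> unif ^ (M * (p - 1))"
    by (simp only: loc_dvd_p_power_iff)
  then obtain c where c: "c \<in> \<O>" "unif ^ (M * (p - 1)) = unif ^ (Suc M * (p - 1)) * c"
    unfolding loc_dvd_def by blast
  \<comment> \<open>Cancelling the common power would make \<open>unif ^ (p - 1)\<close> invertible
    in \<open>\<O>\<close>, although it reduces to 0.\<close>
  have "unif ^ (M * (p - 1)) * 1 = unif ^ (M * (p - 1)) * (unif ^ (p - 1) * c)"
    using c(2) by (simp add: power_add mult_ac)
  hence "unif ^ (p - 1) * c = 1" by (subst (asm) mult_cancel_left) simp
  hence "\<rho> (unif ^ (p - 1) * c) = 1" by simp
  thus False using c(1) p_gt_1 by (simp add: power_0_left)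
qed

end

section \<open>From the least digit sum to the valuation of the code\<close>

theorem theorem4p3:
  fixes p e q m N h k :: nat
    and n :: "nat \<Rightarrow> nat"
    and \<gamma> :: "nat \<Rightarrow> 'a::{field, finite}"
    and s :: "nat \<Rightarrow> nat \<Rightarrow> nat"
    and A :: "(nat \<Rightarrow> nat) set"
    and C :: "((nat \<Rightarrow> nat) \<Rightarrow> 'a) set"
  assumes p_prime: "prime p"
    and e_pos: "0 < e"
    and q_def: "q = p ^ e"
    and n_pos: "\<forall>l<h. 0 < n l"
    and A_def: "A = (\<Pi>\<^sub>E l\<in>{..<h}. {..<n l})"
    and N_def: "N = Lcm (n ` {..<h})"
    and coprime_Nq: "coprime N q"
    and m_def: "m = ord N q"
    and card_field: "card (UNIV :: 'a set) = q ^ m"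
    and gamma_prim: "\<forall>l<h. primitive_root_of_unity (n l) (\<gamma> l)"
    and k_pos: "0 < k"
    and s_in_A: "\<forall>i<k. \<forall>l<h. s i l < n l"
    and C_def: "C = {(\<lambda>j\<in>A. trace q m (\<Sum>i<k. \<alpha> i * (\<Prod>l<h. \<gamma> l ^ (s i l * j l)))) | \<alpha>. True}"
  shows "real (code_p_adic_valuation p A C) =
    Min {(\<Sum>i<k. real (digit_sum p (r i))) / (real p - 1) - real e | r.
           (\<forall>i<k. r i \<le> q ^ m - 1) \<and> (\<forall>i\<ge>k. r i = 0) \<and>
           0 < (\<Sum>i<k. r i) \<and> (q - 1) dvd (\<Sum>i<k. r i) \<and>
           (\<forall>l<h. n l dvd (\<Sum>i<k. r i * s i l))}"
proof -
  have card: "CARD('a) = p ^ (e * m)" using card_field by (simp add: q_def power_mult)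
  obtain \<O> \<rho> and T :: "'a \<Rightarrow> complex" and \<zeta>
    where teich: "teichmueller p (e * m) (p ^ (e * m)) \<O> \<rho> T \<zeta>"
    using teichmueller_exists[OF p_prime card] .
  interpret trace_code p "e * m" "p ^ (e * m)" \<O> T \<zeta> q e m \<rho> h k n \<gamma> s
    using teich e_pos q_def gamma_prim
    by (intro trace_code.intro teichmueller_subfield.intro teichmueller_subfield_axioms.intro
        trace_code_axioms.intro) auto
  have Q: "q ^ m = p ^ (e * m)" by (rule Q_eq_q[symmetric])
  let ?W = weight and ?\<Omega> = exponents and ?S = "\<lambda>r. \<Sum>i<k. digit_sum p (r i)"
  define \<mu> where "\<mu> = Min (?S ` ?\<Omega>)"
  have fin: "finite ?\<Omega>" by (rule finite_exponents)
  \<comment> \<open>All entries equal to \<open>Q - 1\<close> satisfy every congruence, and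
    \<open>0 < k\<close> makes the total positive; so the minimum is over a nonempty set.\<close>
  have "(\<lambda>i\<in>{..<k}. p ^ (e * m) - 1) \<in> ?\<Omega>"
  proof -
    have "n l dvd (\<Sum>i<k. (p ^ (e * m) - 1) * s i l)" if "l < h" for l
      using n_dvd_Q_minus_1[OF that] by (intro dvd_sum) simp
    thus ?thesis
      using k_pos Q_gt_1 minus_1_dvd_power_minus_1[of q m] unfolding Q
      by (auto simp: exponents_def)
  qed
  hence ne: "?\<Omega> \<noteq> {}" by blast
  have \<mu>_le: "\<mu> \<le> ?S r" if "r \<in> ?\<Omega>" for r
    unfolding \<mu>_def using fin that by (intro Min_le) auto
  have "\<mu> \<in> ?S ` ?\<Omega>" unfolding \<mu>_def using fin ne by (intro Min_in) auto
  then obtain r0 where r0: "r0 \<in> ?\<Omega>" "?S r0 = \<mu>" by blast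
  \<comment> \<open>A digit sum agrees with its number modulo \<open>p - 1\<close>, and
    \<open>q - 1\<close> divides the sum of the \<open>r0 i\<close>.\<close>
  have "p - 1 dvd \<mu>"
  proof -
    have "[\<mu> = (\<Sum>i<k. r0 i)] (mod (p - 1))"
      unfolding r0(2)[symmetric] by (intro cong_sum digit_sum_cong p_gt_1)
    moreover have "p - 1 dvd q - 1" unfolding q_def by (rule minus_1_dvd_power_minus_1)
    hence "p - 1 dvd (\<Sum>i<k. r0 i)" using r0(1) dvd_trans by (auto simp: exponents_def)
    ultimately show ?thesis using cong_dvd_iff by blast
  qed
  then obtain M where M: "\<mu> = M * (p - 1)" by (metis dvdE mult.commute)
  have dvd: "p ^ M dvd q * ?W \<alpha>" for \<alpha>
    using power_dvd_weight[of M] \<mu>_le M by simp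
  obtain \<alpha>0 where \<alpha>0: "\<not> p ^ Suc M dvd q * ?W \<alpha>0"
    using exists_weight_not_dvd[OF r0(1)] r0(2) M by blast
  \<comment> \<open>If \<open>M < e\<close>, then \<open>p ^ Suc M\<close> would divide
    \<open>q\<close>, hence every \<open>q * weight \<alpha>\<close>.\<close>
  have "e \<le> M"
  proof (rule ccontr)
    assume "\<not> e \<le> M"
    hence "p ^ Suc M dvd q" unfolding q_def by (intro le_imp_power_dvd) simp
    thus False using \<alpha>0 by simp
  qed
  have div_iff: "(\<forall>c\<in>C. p ^ t dvd hamming_weight A c) \<longleftrightarrow> (\<forall>\<alpha>. p ^ t dvd ?W \<alpha>)" for t
    unfolding C_def weight_def group_set_def A_def[symmetric]
    by (auto simp: hamming_weight_restrict)
  have val: "code_p_adic_valuation p A C = M - e"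
    unfolding code_p_adic_valuation_def div_iff
  proof (rule Greatest_equality)
    show "\<forall>\<alpha>. p ^ (M - e) dvd ?W \<alpha>"
    proof
      fix \<alpha>
      have "p ^ e * p ^ (M - e) dvd p ^ e * ?W \<alpha>"
        using dvd[of \<alpha>] \<open>e \<le> M\<close> by (simp add: q_def flip: power_add)
      thus "p ^ (M - e) dvd ?W \<alpha>" using p_pos by simp
    qed
  next
    fix t assume t: "\<forall>\<alpha>. p ^ t dvd ?W \<alpha>"
    show "t \<le> M - e"
    proof (rule ccontr)
      assume "\<not> t \<le> M - e"
      hence "p ^ Suc M dvd p ^ (e + t)" by (intro le_imp_power_dvd) simp
      also have "p ^ (e + t) dvd q * ?W \<alpha>0" using t by (simp add: q_def power_add)
      finally show False using \<alpha>0 by blast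
    qed
  qed
  let ?v = "\<lambda>r. (\<Sum>i<k. real (digit_sum p (r i))) / (real p - 1) - real e"
  let ?R = "{?v r | r. (\<forall>i<k. r i \<le> q ^ m - 1) \<and> (\<forall>i\<ge>k. r i = 0) \<and>
           0 < (\<Sum>i<k. r i) \<and> (q - 1) dvd (\<Sum>i<k. r i) \<and>
           (\<forall>l<h. n l dvd (\<Sum>i<k. r i * s i l))}"
  \<comment> \<open>Outside the indices below \<open>k\<close> the vectors are
    \<open>undefined\<close> in \<open>exponents\<close> and 0 in the statement; restricting or
    padding changes none of the sums.\<close>
  have R: "?R = ?v ` ?\<Omega>"
  proof (intro equalityI subsetI)
    fix x assume "x \<in> ?R"
    then obtain r where r: "x = ?v r" "\<forall>i<k. r i \<le> q ^ m - 1" "0 < (\<Sum>i<k. r i)"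
      "(q - 1) dvd (\<Sum>i<k. r i)" "\<forall>l<h. n l dvd (\<Sum>i<k. r i * s i l)" by blast
    have "r i < p ^ (e * m)" if "i < k" for i
      using r(2) that Q_gt_1 unfolding Q by fastforce
    hence "restrict r {..<k} \<in> ?\<Omega>" using r(3-5) by (auto simp: exponents_def)
    moreover have "x = ?v (restrict r {..<k})" using r(1) by simp
    ultimately show "x \<in> ?v ` ?\<Omega>" by blast
  next
    fix x assume "x \<in> ?v ` ?\<Omega>"
    then obtain r where r: "x = ?v r" "r \<in> ?\<Omega>" by blast
    have "r i \<le> q ^ m - 1" if "i < k" for i
    proof -
      have "r i < p ^ (e * m)" using r(2) that by (auto simp: exponents_def)
      thus ?thesis unfolding Q by simp
    qed
    thus "x \<in> ?R"
      using r by (intro CollectI exI[of _ "\<lambda>i. if i < k then r i else 0"])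
        (auto simp: exponents_def)
  qed
  have v: "?v r = real (?S r) / (real p - 1) - real e" for r by simp
  have p1: "real p - 1 > 0" using p_gt_1 by simp
  \<comment> \<open>The natural subtraction is exact because \<open>e \<le> M\<close>.\<close>
  have M_real: "real (M - e) = real \<mu> / (real p - 1) - real e"
    using p_gt_1 \<open>e \<le> M\<close> by (simp add: M of_nat_diff)
  have "Min ?R = real (M - e)"
    unfolding R
  proof (rule Min_eqI)
    show "finite (?v ` ?\<Omega>)" using fin by simp
    show "real (M - e) \<le> y" if "y \<in> ?v ` ?\<Omega>" for y
    proof -
      from that obtain r where r: "r \<in> ?\<Omega>" "y = ?v r" by blast
      have "real \<mu> \<le> real (?S r)" using \<mu>_le[OF r(1)] by (simp only: of_nat_le_iff)
      thus ?thesis unfolding r(2) v M_real using p1 by (simp add: divide_right_mono)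
    qed
    show "real (M - e) \<in> ?v ` ?\<Omega>"
      unfolding M_real r0(2)[symmetric] using r0(1) by (auto simp del: of_nat_sum simp: v)
  qed
  thus ?thesis unfolding val ..
qed

end
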